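(* For all $1\le s\le 3$, $$\beta_s = \beta_s^{\mathrm{rad}} := \inf\left\{\frac{I_s(\mu)}{\int_{\mathbb{R}^3}|x|^{s-1}d\mu(x)} : \mu\in D_s(\mathbb{R}^3),\ \mu \text{ radial}\right\}.$$
   Context: For a Borel probability measure $\mu$ on $\mathbb{R}^3$ let $I_s(\mu):=\iint_{\mathbb{R}^3\times\mathbb{R}^3}\frac{|x|^s+|y|^s}{2|x-y|}\,d\mu(x)\,d\mu(y)\in[0,\infty]$. $D_s(\mathbb{R}^3)$ is the set of Borel probability measures $\mu$ on $\mathbb{R}^3$ with $\int\frac{|\hat\mu(k)|^2}{1+|k|^2}dk<\infty$ (i.e. $\mu\in H^{-1}(\mathbb{R}^3)$) and $\int|x|^{s-1}d\mu<\infty$; $\beta_s:=\inf\{I_s(\mu)/\int|x|^{s-1}d\mu : \mu\in D_s(\mathbb{R}^3)\}$. The radial part $\bar\rho$ of a probability measure $\rho$ is defined by $\int f\,d\bar\rho = \int\int_{SO(3)} f(U^{-1}x)\,dU\,d\rho(x)$ for bounded measurable $f$, with $dU$ normalized Haar measure; $\rho$ is radial if $\rho=\bar\rho$. *)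

theory Defs
  imports "HOL-Probability.Probability"
begin

text \<open>Real power with the convention r^0 = 1 (also at r = 0); for a > 0 and r = 0 it is 0.\<close>
definition rpow :: "real \<Rightarrow> real \<Rightarrow> real" where
  "rpow r a = (if a = 0 then 1 else r powr a)"

definition borel_prob :: "(real^3) measure \<Rightarrow> bool" where
  "borel_prob M \<longleftrightarrow> prob_space M \<and> sets M = sets borel"

definition fourier_meas :: "(real^3) measure \<Rightarrow> real^3 \<Rightarrow> complex" where
  "fourier_meas M k = (\<integral>x. cis (- (k \<bullet> x)) \<partial>M)"

definition moment :: "real \<Rightarrow> (real^3) measure \<Rightarrow> ennreal" where
  "moment s M = (\<integral>\<^sup>+ x. ennreal (rpow (norm x) (s - 1)) \<partial>M)"

text \<open>I_s(\<mu>), with values in [0,\<infinity>] (ennreal conventions: a/0 = \<infinity> for a > 0, 0/0 = 0).\<close>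
definition I_s :: "real \<Rightarrow> (real^3) measure \<Rightarrow> ennreal" where
  "I_s s M = (\<integral>\<^sup>+ z. ennreal (rpow (norm (fst z)) s + rpow (norm (snd z)) s)
                        / (2 * ennreal (norm (fst z - snd z))) \<partial>(M \<Otimes>\<^sub>M M))"

text \<open>D_s(R^3): Borel probability measures in H^{-1} with finite (s-1)-moment.\<close>
definition D_s :: "real \<Rightarrow> (real^3) measure \<Rightarrow> bool" where
  "D_s s M \<longleftrightarrow> borel_prob M
     \<and> (\<integral>\<^sup>+ k. ennreal ((cmod (fourier_meas M k))\<^sup>2 / (1 + (norm k)\<^sup>2)) \<partial>lborel) < \<infinity>
     \<and> moment s M < \<infinity>"

definition SO3 :: "(real^3^3) set" where
  "SO3 = {U. orthogonal_matrix U \<and> det U = 1}"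

definition haar_SO3 :: "(real^3^3) measure \<Rightarrow> bool" where
  "haar_SO3 H \<longleftrightarrow> prob_space H \<and> sets H = sets borel \<and> emeasure H SO3 = 1
     \<and> (\<forall>U\<in>SO3. distr H borel (\<lambda>V. U ** V) = H)"

text \<open>\<rho> is radial iff \<rho> equals its radial part, i.e. for every bounded measurable f,
  \<integral> f d\<rho> = \<integral>\<integral>_{SO(3)} f(U^{-1} x) dU d\<rho>(x), dU the normalized Haar measure.\<close>
definition radial :: "(real^3) measure \<Rightarrow> bool" where
  "radial M \<longleftrightarrow> (\<forall>H. haar_SO3 H \<longrightarrow>
     (\<forall>f :: real^3 \<Rightarrow> real. f \<in> borel_measurable borel \<and> bounded (range f) \<longrightarrow>
        (\<integral>x. f x \<partial>M) = (\<integral>x. (\<integral>U. f (matrix_inv U *v x) \<partial>H) \<partial>M)))"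

definition beta :: "real \<Rightarrow> ennreal" where
  "beta s = Inf {I_s s M / moment s M | M. D_s s M}"

definition beta_rad :: "real \<Rightarrow> ennreal" where
  "beta_rad s = Inf {I_s s M / moment s M | M. D_s s M \<and> radial M}"

end

theory Submission
  imports Defs
begin

text \<open>
  Averaging \<open>\<mu>\<close> over rotations preserves membership in \<open>D_s\<close> and the moment, so it suffices that it
  does not increase \<open>I_s\<close>. With \<open>m\<close>, \<open>m'\<close> the larger and smaller of \<open>|x|\<close>, \<open>|y|\<close>, the multipole expansion
  writes the kernel \<open>(|x|^s + |y|^s) / (2 |x - y|)\<close> as the sum over \<open>l\<close> of
  \<open>(m^s + m'^s) / 2 * m'^l / m^(l+1) * P_l(cos \<theta>)\<close>. The term \<open>l = 0\<close> depends on the radii only and is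
  all that survives averaging. For \<open>l \<ge> 1\<close> the radial factor is half the sum of
  \<open>(|x||y|)^(s-1-l) * m'^(2l+1-s)\<close> and \<open>(|x||y|)^(-l-1) * m'^(2l+1+s)\<close>; since \<open>2l + 1 - s \<ge> 0\<close> exactly
  when \<open>s \<le> 2l + 1\<close>, which \<open>s \<le> 3\<close> guarantees, both are positive definite, being positive powers of a minimum
  (layer cake). The Legendre factor is positive definite because it is a Haar average of
  \<open>(\<zeta> \<bullet> x)^l\<close> times the conjugate of \<open>(\<zeta> \<bullet> y)^l\<close> over null vectors \<open>\<zeta>\<close>. Hence the terms \<open>l \<ge> 1\<close> contribute a nonnegative amount
  to \<open>I_s \<mu>\<close> and nothing to the average. The expansion is made absolutely convergent by a damping
  factor \<open>\<kappa>^l\<close>, \<open>\<kappa> < 1\<close>. If no Haar measure existed, every measure would be radial by definition, so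
  one may be assumed.
\<close>

section \<open>Legendre polynomials in homogeneous form\<close>

text \<open>The Fourier argument for positive definiteness of \<open>1 / |x - y|\<close> does not
  apply directly to this kernel, because the weight \<open>|x|^s + |y|^s\<close> is not a product.
  Positivity is therefore sought in each angular degree separately, and only for
  \<open>l >= 1\<close>. Degree 1 is the tight one: there the minimum carries the exponent
  \<open>3 - s\<close>. In degree 0 the exponent would be \<open>1 - s\<close>, but that term passes
  unchanged to the average and needs no positive definiteness.

  No basis of spherical harmonics is built. Powers of the pairing with rotated null vectors take its
  place, and the addition theorem follows from invariance alone. Its constant is never evaluated;
  positivity is enough.

  The limit \<kappa> -> 1 is taken twice, in different ways. For \<open>I_s\<close> of the given
  measure a lower bound is wanted, and the damped kernels are dominated by twice the original one.
  For the rotational average only an upper bound is wanted, so Fatou's lemma suffices, and the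
  singularity where the rotated \<open>y\<close> meets \<open>x\<close> needs no separate
  estimate.\<close>

text \<open>\<open>q^(l/2) * P_l(t / sqrt q)\<close> with the Legendre polynomial \<open>P_l\<close>; used for \<open>t = x \<bullet> y\<close>, \<open>q = |x|\<^sup>2 |y|\<^sup>2\<close>. The coefficients
  are those of Laplace's formula, the average over \<open>\<phi>\<close> of \<open>(t + i sqrt (q - t\<^sup>2) cos \<phi>)^l\<close>; averaging over \<open>N > l\<close> roots of unity
  is exact and avoids integration.\<close>
definition legendre_form :: "nat \<Rightarrow> 'a::field_char_0 \<Rightarrow> 'a \<Rightarrow> 'a" where
  "legendre_form l t q = (\<Sum>j\<le>l. of_nat ((l choose (2*j)) * ((2*j) choose j)) * t^(l - 2*j) * ((t\<^sup>2 - q)/4)^j)"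

section \<open>Averages over roots of unity and the Legendre coefficients\<close>

lemma sum_cis_roots:
  fixes m :: int and N :: nat
  assumes "\<bar>m\<bar> < int N"
  shows "(\<Sum>n<N. cis (2 * pi * real n * real_of_int m / real N)) = (if m = 0 then of_nat N else 0)"
proof (cases "m = 0")
  case False
  define w where "w = cis (2 * pi * real_of_int m / real N)"
  have N: "N > 0" using assms by linarith
  have wn: "cis (2 * pi * real n * real_of_int m / real N) = w ^ n" for n
    unfolding w_def Complex.DeMoivre by (rule arg_cong[where f=cis]) (simp add: mult_ac)
  have "w ^ N = cis (2 * pi * real_of_int m)"
    unfolding w_def Complex.DeMoivre using N by simp
  also have "\<dots> = 1" by (simp add: cis_multiple_2pi)
  finally have wN: "w ^ N = 1" .
  have "w \<noteq> 1"
  proof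
    assume "w = 1"
    then have "cos (2 * pi * real_of_int m / real N) = 1"
      by (metis w_def cis.simps(1) one_complex.simps(1))
    then obtain k :: int where "2 * pi * real_of_int m / real N = of_int k * 2 * pi"
      using cos_one_2pi_int by auto
    then have "real_of_int m = real_of_int (k * int N)" using N by (simp add: field_simps)
    then have "m = k * int N" by linarith
    then have "int N dvd m" by simp
    with assms False show False using dvd_imp_le_int[of m "int N"] by simp
  qed
  then have "(\<Sum>n<N. w ^ n) = 0" using wN by (simp add: geometric_sum)
  then show ?thesis using False by (simp add: wn)
qed simp

text \<open>Expanding the power gives frequencies \<open>2 * k - i\<close> with
  \<open>i \<le> l\<close>, all smaller than \<open>N\<close> in absolute value. No aliasing occurs,
  so only the constant terms \<open>i = 2 * k\<close> survive, and in them \<open>b\<close> and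
  \<open>g\<close> appear to equal powers.\<close>

lemma roots_average_power:
  fixes \<alpha> b g :: complex
  assumes "l < N"
  shows "(\<Sum>n<N. (\<alpha> + b * cis (2*pi*real n/real N) + g * cis (-(2*pi*real n/real N)))^l) / of_nat N
    = (\<Sum>j\<le>l. of_nat ((l choose (2*j)) * ((2*j) choose j)) * \<alpha>^(l - 2*j) * (b * g)^j)"
proof -
  let ?th = "\<lambda>n. 2*pi*real n/real N"
  have N: "N > 0" using assms by simp
  have *: "(\<alpha> + b * cis (?th n) + g * cis (-?th n))^l
     = (\<Sum>i\<le>l. \<Sum>k\<le>i. of_nat (l choose i) * of_nat (i choose k) * \<alpha>^(l-i) * b^k * g^(i-k)
         * cis (2*pi*real n*real_of_int (2 * int k - int i)/real N))" for n
  proof -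
    have "(\<alpha> + b * cis (?th n) + g * cis (-?th n))^l = ((b * cis (?th n) + g * cis (-?th n)) + \<alpha>)^l"
      by (simp add: algebra_simps)
    also have "\<dots> = (\<Sum>i\<le>l. of_nat (l choose i) * (b * cis (?th n) + g * cis (-?th n))^i * \<alpha>^(l-i))"
      by (rule binomial_ring)
    also have "\<dots> = (\<Sum>i\<le>l. \<Sum>k\<le>i. of_nat (l choose i) * of_nat (i choose k) * \<alpha>^(l-i) * b^k * g^(i-k)
         * cis (2*pi*real n*real_of_int (2 * int k - int i)/real N))"
    proof (rule sum.cong[OF refl])
      fix i
      have c: "cis (?th n)^k * cis (- ?th n)^(i-k) = cis (2*pi*real n*real_of_int (2 * int k - int i)/real N)" if "k \<le> i" for k
        unfolding Complex.DeMoivre cis_mult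
        using that N by (intro arg_cong[where f=cis]) (simp add: of_nat_diff field_simps)
      have "of_nat (l choose i) * (b * cis (?th n) + g * cis (-?th n))^i * \<alpha>^(l-i)
        = (\<Sum>k\<le>i. of_nat (l choose i) * of_nat (i choose k) * \<alpha>^(l-i) * b^k * g^(i-k) * (cis (?th n)^k * cis (- ?th n)^(i-k)))"
        unfolding binomial_ring sum_distrib_left sum_distrib_right power_mult_distrib
        by (rule sum.cong[OF refl]) (simp only: mult_ac)
      also have "\<dots> = (\<Sum>k\<le>i. of_nat (l choose i) * of_nat (i choose k) * \<alpha>^(l-i) * b^k * g^(i-k)
         * cis (2*pi*real n*real_of_int (2 * int k - int i)/real N))"
        by (rule sum.cong[OF refl], subst c) auto
      finally show "of_nat (l choose i) * (b * cis (?th n) + g * cis (-?th n))^i * \<alpha>^(l-i) = \<dots>" .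
    qed
    finally show ?thesis .
  qed
  have "(\<Sum>n<N. (\<alpha> + b * cis (?th n) + g * cis (-?th n))^l)
    = (\<Sum>i\<le>l. \<Sum>k\<le>i. of_nat (l choose i) * of_nat (i choose k) * \<alpha>^(l-i) * b^k * g^(i-k)
         * (\<Sum>n<N. cis (2*pi*real n*real_of_int (2 * int k - int i)/real N)))"
    unfolding * sum_distrib_left
    by (subst sum.swap, rule sum.cong[OF refl], rule sum.swap)
  also have "\<dots> = (\<Sum>i\<le>l. \<Sum>k\<le>i. of_nat (l choose i) * of_nat (i choose k) * \<alpha>^(l-i) * b^k * g^(i-k)
         * (if i = 2 * k then of_nat N else 0))"
    using assms by (intro sum.cong refl, subst sum_cis_roots) auto
  also have "\<dots> = (\<Sum>i\<le>l. if even i then of_nat N * (of_nat (l choose i) * of_nat (i choose (i div 2)) * \<alpha>^(l-i) * (b*g)^(i div 2)) else 0)"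
  proof (rule sum.cong[OF refl])
    fix i assume "i \<in> {..l}"
    show "(\<Sum>k\<le>i. of_nat (l choose i) * of_nat (i choose k) * \<alpha>^(l-i) * b^k * g^(i-k)
         * (if i = 2 * k then of_nat N else 0)) = (if even i then of_nat N * (of_nat (l choose i) * of_nat (i choose (i div 2)) * \<alpha>^(l-i) * (b*g)^(i div 2)) else 0)"
    proof (cases "even i")
      case True
      then obtain j where j: "i = 2 * j" by auto
      have "(\<Sum>k\<le>i. of_nat (l choose i) * of_nat (i choose k) * \<alpha>^(l-i) * b^k * g^(i-k)
         * (if i = 2 * k then of_nat N else 0)) =
         (\<Sum>k\<le>i. if k = j then of_nat (l choose i) * of_nat (i choose k) * \<alpha>^(l-i) * b^k * g^(i-k) * of_nat N else 0)"
        by (rule sum.cong[OF refl]) (auto simp: j)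
      also have "\<dots> = of_nat (l choose i) * of_nat (i choose j) * \<alpha>^(l-i) * b^j * g^(i-j) * of_nat N"
        by (simp add: j)
      finally show ?thesis using True by (simp add: j power_mult_distrib)
    next
      case False
      then show ?thesis by (auto intro!: sum.neutral)
    qed
  qed
  also have "\<dots> = (\<Sum>i\<in>(*) 2 ` {j. 2 * j \<le> l}. of_nat N * (of_nat (l choose i) * of_nat (i choose (i div 2)) * \<alpha>^(l-i) * (b*g)^(i div 2)))"
    by (subst sum.inter_filter[symmetric]) (auto intro!: sum.cong elim!: evenE)
  also have "\<dots> = (\<Sum>j\<in>{j. 2 * j \<le> l}. of_nat N * (of_nat (l choose (2*j)) * of_nat ((2*j) choose j) * \<alpha>^(l-2*j) * (b*g)^j))"
    by (subst sum.reindex) (auto simp: inj_on_def)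
  also have "\<dots> = (\<Sum>j\<le>l. of_nat N * (of_nat (l choose (2*j)) * of_nat ((2*j) choose j) * \<alpha>^(l-2*j) * (b*g)^j))"
    by (rule sum.mono_neutral_left) (auto simp: binomial_eq_0)
  finally show ?thesis using N by (simp add: sum_distrib_left[symmetric])
qed

lemma legendre_form_of_real:
  "legendre_form l (of_real t) (of_real q :: complex) = of_real (legendre_form l t q)"
  by (simp add: legendre_form_def)

text \<open>Needed for a real factor, the length of a vector, and for a complex one, the last
  coordinate of a null vector; hence the general field in \<open>legendre_form\<close>.\<close>

lemma legendre_form_homogeneous: "legendre_form l (c * t) (c\<^sup>2 * q) = c ^ l * legendre_form l t q"
  unfolding legendre_form_def sum_distrib_left
proof (rule sum.cong[OF refl])
  fix j
  show "of_nat ((l choose (2 * j)) * (2 * j choose j)) * (c * t) ^ (l - 2 * j) * (((c * t)\<^sup>2 - c\<^sup>2 * q) / 4) ^ j =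
         c ^ l * (of_nat ((l choose (2 * j)) * (2 * j choose j)) * t ^ (l - 2 * j) * ((t\<^sup>2 - q) / 4) ^ j)"
  \<comment> \<open>For larger \<open>j\<close> the exponent \<open>l - 2 * j\<close> is truncated
    to 0, but the coefficient \<open>l choose (2*j)\<close> vanishes.\<close>
  proof (cases "2 * j \<le> l")
    case True
    have e1: "((c * t)\<^sup>2 - c\<^sup>2 * q) / 4 = c\<^sup>2 * ((t\<^sup>2 - q) / 4)" by (simp add: power_mult_distrib field_simps)
    have e2: "c ^ l = c ^ (l - 2 * j) * (c\<^sup>2)^j"
      using True by (simp flip: power_mult power_add)
    show ?thesis unfolding e1 e2 by (simp only: power_mult_distrib[of c t] power_mult_distrib[of "c\<^sup>2"] mult_ac)
  qed (simp add: binomial_eq_0)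
qed

lemma legendre_form_0 [simp]: "legendre_form 0 t q = 1"
  by (simp add: legendre_form_def)

lemma legendre_form_average:
  fixes t q :: real
  assumes "t\<^sup>2 \<le> q" "l < N"
  shows "(\<Sum>n<N. (of_real t + \<i> * of_real (sqrt (q - t\<^sup>2) * cos (2*pi*real n/real N)))^l) / of_nat N
    = (of_real (legendre_form l t q) :: complex)"
proof -
  define b where "b = \<i> * of_real (sqrt (q - t\<^sup>2)) / 2"
  have e1: "of_real t + \<i> * of_real (sqrt (q - t\<^sup>2) * cos x) = of_real t + b * cis x + b * cis (-x)" for x
    by (simp add: b_def complex_eq_iff)
  have e2: "b * b = ((of_real t)\<^sup>2 - of_real q) / 4"
  proof -
    have "b * b = - ((complex_of_real (sqrt (q - t\<^sup>2)))\<^sup>2 / 4)"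
      by (simp add: b_def power2_eq_square complex_eq_iff)
    also have "(complex_of_real (sqrt (q - t\<^sup>2)))\<^sup>2 = of_real (q - t\<^sup>2)"
      using assms(1) by (simp del: of_real_diff flip: of_real_power)
    finally show ?thesis by (simp add: field_simps)
  qed
  have e3: "of_real (legendre_form l t q) = (\<Sum>j\<le>l. of_nat ((l choose (2*j)) * ((2*j) choose j)) * of_real t^(l - 2*j) * (((of_real t)\<^sup>2 - of_real q)/4)^j :: complex)"
    by (simp add: legendre_form_def)
  show ?thesis
    unfolding e1 e3 e2[symmetric] by (rule roots_average_power[OF assms(2)])
qed

lemma cmod_legendre_node:
  assumes "t\<^sup>2 \<le> q"
  shows "cmod (of_real t + \<i> * of_real (sqrt (q - t\<^sup>2) * cos x)) \<le> sqrt q"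
proof -
  have "t\<^sup>2 + (sqrt (q - t\<^sup>2) * cos x)\<^sup>2 \<le> q"
  proof -
    have "(q - t\<^sup>2) * (cos x)\<^sup>2 \<le> (q - t\<^sup>2) * 1"
      using assms by (intro mult_left_mono) (auto simp: abs_square_le_1)
    then show ?thesis using assms by (simp add: power_mult_distrib)
  qed
  then show ?thesis by (simp add: cmod_def)
qed

text \<open>The homogeneous form of \<open>|P_l| \<le> 1\<close>: every node of Laplace's average
  has modulus at most \<open>sqrt q\<close>.\<close>

lemma abs_legendre_form_le:
  assumes "t\<^sup>2 \<le> q"
  shows "\<bar>legendre_form l t q\<bar> \<le> sqrt q ^ l"
proof -
  have "cmod (of_real (legendre_form l t q)) =
    cmod ((\<Sum>n<Suc l. (of_real t + \<i> * of_real (sqrt (q - t\<^sup>2) * cos (2*pi*real n/real (Suc l))))^l) / of_nat (Suc l))"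
    by (simp only: legendre_form_average[OF assms lessI])
  also have "\<dots> = cmod (\<Sum>n<Suc l. (of_real t + \<i> * of_real (sqrt (q - t\<^sup>2) * cos (2*pi*real n/real (Suc l))))^l) / real (Suc l)"
    by (simp only: norm_divide norm_of_nat)
  also have "\<dots> \<le> (\<Sum>n<Suc l. sqrt q ^ l) / real (Suc l)"
  proof (intro divide_right_mono sum_norm_le)
    fix n
    show "cmod ((of_real t + \<i> * of_real (sqrt (q - t\<^sup>2) * cos (2*pi*real n/real (Suc l))))^l) \<le> sqrt q ^ l"
      unfolding norm_power by (intro power_mono cmod_legendre_node assms norm_ge_zero)
  qed simp
  also have "\<dots> = sqrt q ^ l" by simp
  finally show ?thesis by simp
qed

text \<open>This is \<open>P_l(0)\<close>. Only \<open>j = l / 2\<close> contributes, so the value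
  is 0 for odd \<open>l\<close> and a central binomial coefficient over \<open>4^(l/2)\<close>, up
  to sign, for even \<open>l\<close>.\<close>

lemma legendre_form_0_1_neq_1:
  assumes "l \<ge> 1"
  shows "legendre_form l 0 (1::real) \<noteq> 1"
proof -
  have eq: "legendre_form l 0 (1::real) = (\<Sum>j\<le>l. if 2 * j = l then real (l choose j) * (-1/4)^j else 0)"
    unfolding legendre_form_def
  proof (rule sum.cong[OF refl])
    fix j
    show "real ((l choose (2 * j)) * (2 * j choose j)) * 0 ^ (l - 2 * j) * ((0\<^sup>2 - 1) / 4) ^ j =
         (if 2 * j = l then real (l choose j) * (-1/4)^j else 0)"
      by (cases "2 * j < l"; cases "2 * j = l") (auto simp: binomial_eq_0)
  qed
  show ?thesis
  proof (cases "even l")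
    case True
    then obtain i where i: "l = 2 * i" by auto
    have "legendre_form l 0 (1::real) = (\<Sum>j\<le>l. if j = i then real (l choose j) * (-1/4)^j else 0)"
      unfolding eq by (rule sum.cong) (auto simp: i)
    then have v: "legendre_form l 0 (1::real) = real (l choose i) * (-1/4)^i"
      by (simp add: i)
    \<comment> \<open>Keeping the end coefficient beside the central one makes the comparison with
      the row sum \<open>2 ^ l\<close> strict.\<close>
    have "(l choose 0) + (l choose i) = (\<Sum>k\<in>{0,i}. l choose k)" using assms i by simp
    also have "\<dots> \<le> (\<Sum>k\<le>l. l choose k)" by (rule sum_mono2) (auto simp: i)
    also have "\<dots> = 2 ^ l" by (rule choose_row_sum)
    finally have "(l choose i) < 4 ^ i" by (simp add: i power_mult)
    then have "real (l choose i) < 4 ^ i" by (metis of_nat_less_iff of_nat_numeral of_nat_power)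
    then have "\<bar>legendre_form l 0 (1::real)\<bar> < 1"
      by (simp add: v abs_mult power_abs power_divide)
    then show ?thesis by auto
  next
    case False
    then have "legendre_form l 0 (1::real) = 0" unfolding eq by (intro sum.neutral) auto
    then show ?thesis by simp
  qed
qed

section \<open>The generating function of the Legendre polynomials\<close>

text \<open>For an \<open>N\<close>-th root of unity \<open>w\<close>,
  \<open>1 / (1 - Q * w)\<close> is the finite sum of \<open>(Q * w)^k\<close> over
  \<open>k < N\<close>, divided by \<open>1 - Q^N\<close>; averaging removes every
  \<open>k > 0\<close>. Both signs of \<open>m\<close> are needed, for \<open>cis x\<close> and for
  \<open>cis (-x)\<close>.\<close>

lemma roots_average_geometric:
  fixes Q :: complex and m :: int
  assumes "cmod Q < 1" "N > 0" "\<bar>m\<bar> = 1"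
  shows "(\<Sum>n<N. 1 / (1 - Q * cis (2*pi*real n*real_of_int m/real N))) / of_nat N = 1 / (1 - Q ^ N)"
proof -
  have QN: "Q ^ N \<noteq> 1"
  proof
    assume "Q ^ N = 1"
    then have "cmod Q ^ N = 1" by (simp flip: norm_power)
    moreover have "cmod Q ^ N < 1" using assms by (simp add: power_less_one_iff)
    ultimately show False by simp
  qed
  let ?w = "\<lambda>n. cis (2*pi*real n*real_of_int m/real N)"
  have p: "?w n ^ k = cis (2*pi*real n*real_of_int (m * int k)/real N)" for n k
    unfolding Complex.DeMoivre by (rule arg_cong[where f=cis]) (simp add: mult_ac)
  have *: "1 / (1 - Q * ?w n) = (\<Sum>k<N. Q^k * cis (2*pi*real n*real_of_int (m * int k)/real N)) / (1 - Q^N)" for n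
  proof -
    have "?w n ^ N = cis (2 * pi * real_of_int (int n * m))"
      unfolding Complex.DeMoivre using assms(2) by (intro arg_cong[where f=cis]) (simp add: mult_ac)
    also have "\<dots> = 1" by (rule cis_multiple_2pi) simp
    finally have wN: "(Q * ?w n) ^ N = Q ^ N" by (simp add: power_mult_distrib)
    have "Q * ?w n \<noteq> 1"
    proof
      assume "Q * ?w n = 1"
      then have "Q ^ N = 1" using wN by simp
      then show False using QN by simp
    qed
    then have "(\<Sum>k<N. (Q * ?w n)^k) = (1 - Q^N) / (1 - Q * ?w n)"
      using wN by (subst geometric_sum) (auto simp: field_simps)
    then have "1 / (1 - Q * ?w n) = (\<Sum>k<N. (Q * ?w n)^k) / (1 - Q^N)"
      using QN by simp
    then show ?thesis by (simp only: power_mult_distrib p)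
  qed
  have "(\<Sum>n<N. 1 / (1 - Q * ?w n)) = (\<Sum>k<N. Q^k * (\<Sum>n<N. cis (2*pi*real n*real_of_int (m * int k)/real N))) / (1 - Q^N)"
    unfolding * sum_divide_distrib[symmetric] sum_distrib_left by (subst sum.swap) simp
  also have "(\<Sum>k<N. Q^k * (\<Sum>n<N. cis (2*pi*real n*real_of_int (m * int k)/real N))) = (\<Sum>k<N. if k = 0 then of_nat N else 0)"
  proof (rule sum.cong[OF refl])
    fix k assume "k \<in> {..<N}"
    then have "\<bar>m * int k\<bar> < int N" using assms(3) by (simp add: abs_mult)
    moreover have "m \<noteq> 0" using assms(3) by auto
    ultimately show "Q^k * (\<Sum>n<N. cis (2*pi*real n*real_of_int (m * int k)/real N)) = (if k = 0 then of_nat N else 0)"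
      by (subst sum_cis_roots) auto
  qed
  also have "\<dots> = of_nat N" using assms(2) by simp
  finally show ?thesis using assms(2) by simp
qed

text \<open>The discrete counterpart of the mean of \<open>1 / (A - i B cos x)\<close> over the
  circle. The denominator factors into a part in \<open>cis x\<close> and a part in
  \<open>cis (-x)\<close>, and partial fractions reduce the average to two geometric ones.\<close>

lemma roots_average_kernel:
  fixes A B :: real
  assumes "A > 0" "B \<ge> 0"
  shows "(\<lambda>N. (\<Sum>n<N. 1 / (of_real A - \<i> * of_real (B * cos (2*pi*real n/real N)))) / of_nat N)
    \<longlonglongrightarrow> (of_real (1 / sqrt (A\<^sup>2 + B\<^sup>2)) :: complex)"
proof -
  define D where "D = sqrt (A\<^sup>2 + B\<^sup>2)"
  \<comment> \<open>Matching \<open>A - i B cos x\<close> with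
    \<open>c * (1 - i p cis x) * (1 - i p cis (-x))\<close> requires
    \<open>c * (1 - p^2) = A\<close> and \<open>2 * c * p = B\<close>. Then
    \<open>c * (1 + p^2) = D\<close>, and adding the first and the last equation gives
    \<open>2 * c = A + D\<close>.\<close>
  define c where "c = (A + D) / 2"
  define p where "p = B / (2 * c)"
  define Q where "Q = \<i> * complex_of_real p"
  have D2: "D\<^sup>2 = A\<^sup>2 + B\<^sup>2" by (simp add: D_def)
  have D: "D \<ge> B" "D \<ge> A" "D > 0" using assms by (auto simp: D_def real_le_rsqrt intro!: real_sqrt_gt_zero add_pos_nonneg)
  have c: "c > 0" using D assms by (simp add: c_def)
  have p: "0 \<le> p" "p < 1" using c D assms by (auto simp: p_def c_def field_simps)
  have cB: "2 * c * p = B" using c by (simp add: p_def)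
  have cp: "4 * c * (c * p\<^sup>2) = B\<^sup>2" unfolding cB[symmetric] by (simp add: power2_eq_square)
  have "4 * c * (c * (1 - p\<^sup>2)) = 4 * c * A"
    using cp D2 by (simp add: c_def power2_eq_square algebra_simps)
  then have cA: "c * (1 - p\<^sup>2) = A" using c by simp
  have "4 * c * (c * (1 + p\<^sup>2)) = 4 * c * D"
    using cp D2 by (simp add: c_def power2_eq_square algebra_simps)
  then have cD: "c * (1 + p\<^sup>2) = D" using c by simp
  have nQ: "cmod Q < 1" using p by (simp add: Q_def norm_mult)
  have Q2: "1 - Q\<^sup>2 = of_real (1 + p\<^sup>2)" by (simp add: Q_def power_mult_distrib)
  have *: "1 / (of_real A - \<i> * of_real (B * cos x)) = 
      (1 / (1 - Q * cis x) + 1 / (1 - Q * cis (-x)) - 1) / (of_real D)" for x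
  proof -
    have e: "of_real A - \<i> * of_real (B * cos x) = of_real c * ((1 - Q * cis x) * (1 - Q * cis (-x)))"
    proof -
      have "(1 - Q * cis x) * (1 - Q * cis (-x)) = 1 - Q * (cis x + cis (-x)) + Q\<^sup>2 * (cis x * cis (-x))"
        by (simp add: algebra_simps power2_eq_square)
      also have "\<dots> = 1 - Q * of_real (2 * cos x) + Q\<^sup>2" by (simp add: cis_mult complex_eq_iff)
      finally show ?thesis by (simp add: Q_def power_mult_distrib complex_eq_iff cB[symmetric] cA[symmetric] algebra_simps)
    qed
    have n: "1 - Q * cis y \<noteq> 0" for y
    proof
      assume "1 - Q * cis y = 0"
      then have "cmod (Q * cis y) = 1" by (metis eq_iff_diff_eq_0 norm_one)
      then show False using nQ by (simp add: norm_mult)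
    qed
    have cc: "cis x * cis (-x) = 1" by (simp add: cis_mult)
    have "1 / (1 - Q * cis x) + 1 / (1 - Q * cis (-x)) - 1 = 
       ((1 - Q * cis (-x)) + (1 - Q * cis x) - (1 - Q * cis x) * (1 - Q * cis (-x))) / ((1 - Q * cis x) * (1 - Q * cis (-x)))"
    proof -
      have "1 / u + 1 / v - 1 = (v + u - u * v) / (u * v)" if "u \<noteq> 0" "v \<noteq> 0" for u v :: complex
        using that by (simp add: field_simps)
      then show ?thesis using n by blast
    qed
    also have "(1 - Q * cis (-x)) + (1 - Q * cis x) - (1 - Q * cis x) * (1 - Q * cis (-x)) = 1 - Q\<^sup>2 * (cis x * cis (-x))"
      by (simp add: algebra_simps power2_eq_square)
    also have "\<dots> = of_real (1 + p\<^sup>2)" unfolding cc by (simp add: Q2)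
    finally have f: "1 / (1 - Q * cis x) + 1 / (1 - Q * cis (-x)) - 1 = of_real (1 + p\<^sup>2) / ((1 - Q * cis x) * (1 - Q * cis (-x)))" .
    have "1 + p\<^sup>2 > 0" by (simp add: add_pos_nonneg)
    then have "complex_of_real (1 + p\<^sup>2) \<noteq> 0" by (metis of_real_eq_0_iff less_irrefl)
    then show ?thesis unfolding e f cD[symmetric] using c n by (simp add: divide_simps)
  qed
  have **: "(\<Sum>n<N. 1 / (of_real A - \<i> * of_real (B * cos (2*pi*real n/real N)))) / of_nat N = (2 / (1 - Q^N) - 1) / of_real D"
    if N: "N > 0" for N
  proof -
    have "(\<Sum>n<N. 1 / (of_real A - \<i> * of_real (B * cos (2*pi*real n/real N)))) / of_nat N = 
      ((\<Sum>n<N. 1 / (1 - Q * cis (2*pi*real n*real_of_int 1/real N))) / of_nat N 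
      + (\<Sum>n<N. 1 / (1 - Q * cis (2*pi*real n*real_of_int (-1)/real N))) / of_nat N - 1) / of_real D"
      unfolding * sum_divide_distrib[symmetric] sum.distrib sum_subtractf
      using N by (simp add: add_divide_distrib diff_divide_distrib mult.commute)
    also have "\<dots> = (2 / (1 - Q^N) - 1) / of_real D"
      using N nQ by (subst (1 2) roots_average_geometric) auto
    finally show ?thesis .
  qed
  have "(\<lambda>N. (2 / (1 - Q^N) - 1) / of_real D) \<longlonglongrightarrow> (2 / (1 - 0) - 1) / of_real D"
    using D by (intro tendsto_intros LIMSEQ_power_zero nQ) auto
  then have "(\<lambda>N. (2 / (1 - Q^N) - 1) / of_real D) \<longlonglongrightarrow> of_real (1 / D)" by simp
  then show ?thesis unfolding D_def[symmetric]
    by (rule Lim_transform_eventually) (use eventually_gt_at_top[of "0::nat"] in eventually_elim, simp only: **)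
qed

text \<open>The number \<open>N\<close> serves both as truncation of the series and as number of
  nodes. All degrees \<open>l < N\<close> are then averaged exactly by the same nodes, so the
  partial sum is an average of finite geometric sums in \<open>r * z\<close>.\<close>

lemma legendre_form_generating_function:
  fixes t q r :: real
  assumes "t\<^sup>2 \<le> q" "0 \<le> r" "r * sqrt q < 1"
  shows "(\<lambda>l. r ^ l * legendre_form l t q) sums (1 / sqrt (1 - 2 * r * t + r\<^sup>2 * q))"
proof -
  define z where "z = (\<lambda>x. complex_of_real t + \<i> * of_real (sqrt (q - t\<^sup>2) * cos x))"
  define A where "A = 1 - r * t"
  define B where "B = r * sqrt (q - t\<^sup>2)"
  define \<rho> where "\<rho> = r * sqrt q"
  have "\<bar>t\<bar> \<le> sqrt q" using assms(1) by (metis real_sqrt_abs real_sqrt_le_iff)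
  then have "r * t \<le> \<rho>" unfolding \<rho>_def using assms(2) by (intro mult_left_mono) auto
  then have A: "A > 0" using assms(3) by (simp add: A_def \<rho>_def)
  have B: "B \<ge> 0" using assms by (simp add: B_def)
  have "q \<ge> 0" using assms(1) by (smt (verit) zero_le_power2)
  then have \<rho>: "0 \<le> \<rho>" "\<rho> < 1" using assms by (auto simp: \<rho>_def)
  have AB: "A\<^sup>2 + B\<^sup>2 = 1 - 2 * r * t + r\<^sup>2 * q"
    using assms(1) by (simp add: A_def B_def power_mult_distrib) (simp add: power2_eq_square algebra_simps)
  have rz: "1 - of_real r * z x = of_real A - \<i> * of_real (B * cos x)" for x
    by (simp add: z_def A_def B_def algebra_simps)
  have nz: "cmod (of_real r * z x) \<le> \<rho>" for x
    unfolding norm_mult \<rho>_def z_def using assms(2) cmod_legendre_node[OF assms(1)]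
    by (intro mult_mono) auto
  \<comment> \<open>The averaged tail of the geometric series; it is of order
    \<open>\<rho>^N\<close> because every node satisfies
    \<open>|r z| \<le> \<rho> < 1\<close>.\<close>
  define err where "err = (\<lambda>N. (\<Sum>n<N. (of_real r * z (2*pi*real n/real N))^N / (1 - of_real r * z (2*pi*real n/real N))) / of_nat N)"
  have err: "cmod (err N) \<le> \<rho> ^ N / (1 - \<rho>)" for N
  proof (cases "N = 0")
    case False
    have "cmod ((of_real r * z x)^N / (1 - of_real r * z x)) \<le> \<rho> ^ N / (1 - \<rho>)" for x
    proof -
      have "1 - \<rho> \<le> cmod (1 - of_real r * z x)"
        using nz[of x] norm_triangle_ineq2[of 1 "of_real r * z x"] by simp
      then show ?thesis unfolding norm_divide norm_power
        using \<rho> nz[of x] by (intro frac_le power_mono) auto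
    qed
    then have "cmod (\<Sum>n<N. (of_real r * z (2*pi*real n/real N))^N / (1 - of_real r * z (2*pi*real n/real N))) 
      \<le> (\<Sum>n<N. \<rho> ^ N / (1 - \<rho>))" by (intro sum_norm_le) auto
    then show ?thesis using False by (simp add: err_def norm_divide field_simps)
  qed (use \<rho> in \<open>simp add: err_def\<close>)
  have err0: "err \<longlonglongrightarrow> 0"
  proof (rule Lim_null_comparison[of _ "\<lambda>N. \<rho> ^ N / (1 - \<rho>)"])
    show "\<forall>\<^sub>F N in sequentially. cmod (err N) \<le> \<rho> ^ N / (1 - \<rho>)" using err by simp
    have "(\<lambda>N. \<rho> ^ N / (1 - \<rho>)) \<longlonglongrightarrow> 0 / (1 - \<rho>)"
      using \<rho> by (intro tendsto_intros LIMSEQ_power_zero) auto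
    then show "(\<lambda>N. \<rho> ^ N / (1 - \<rho>)) \<longlonglongrightarrow> 0" by simp
  qed
  have part: "of_real (\<Sum>l<N. r ^ l * legendre_form l t q) = 
     (\<Sum>n<N. 1 / (1 - of_real r * z (2*pi*real n/real N))) / of_nat N - err N" for N
  proof -
    have ne: "1 - of_real r * z x \<noteq> 0" for x
      using nz[of x] \<rho> by (metis eq_iff_diff_eq_0 norm_one not_less)
    have "complex_of_real (\<Sum>l<N. r ^ l * legendre_form l t q) = (\<Sum>l<N. (\<Sum>n<N. (of_real r * z (2*pi*real n/real N))^l) / of_nat N)"
      unfolding of_real_sum
    proof (rule sum.cong[OF refl])
      fix l assume "l \<in> {..<N}"
      then have "complex_of_real (legendre_form l t q) = (\<Sum>n<N. z (2*pi*real n/real N) ^ l) / of_nat N"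
        using legendre_form_average[OF assms(1), of l N] by (simp add: z_def)
      then show "complex_of_real (r ^ l * legendre_form l t q) = (\<Sum>n<N. (of_real r * z (2*pi*real n/real N))^l) / of_nat N"
        by (simp add: power_mult_distrib sum_distrib_left)
    qed
    also have "\<dots> = (\<Sum>n<N. \<Sum>l<N. (of_real r * z (2*pi*real n/real N))^l) / of_nat N"
      by (subst sum.swap) (simp add: sum_divide_distrib)
    also have "\<dots> = (\<Sum>n<N. 1 / (1 - of_real r * z (2*pi*real n/real N)) 
        - (of_real r * z (2*pi*real n/real N))^N / (1 - of_real r * z (2*pi*real n/real N))) / of_nat N"
      using ne by (intro arg_cong2[where f="(/)"] sum.cong refl, subst sum_gp_strict)
        (auto simp: diff_divide_distrib)
    finally show ?thesis by (simp add: err_def sum_subtractf diff_divide_distrib)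
  qed
  have "(\<lambda>N. (\<Sum>n<N. 1 / (1 - of_real r * z (2*pi*real n/real N))) / of_nat N - err N)
     \<longlonglongrightarrow> of_real (1 / sqrt (A\<^sup>2 + B\<^sup>2)) - 0"
    unfolding rz by (intro tendsto_diff roots_average_kernel A B err0)
  then have "(\<lambda>N. complex_of_real (\<Sum>l<N. r ^ l * legendre_form l t q)) \<longlonglongrightarrow> of_real (1 / sqrt (A\<^sup>2 + B\<^sup>2))"
    unfolding part by simp
  then have "(\<lambda>N. \<Sum>l<N. r ^ l * legendre_form l t q) \<longlonglongrightarrow> 1 / sqrt (A\<^sup>2 + B\<^sup>2)"
    by (simp only: tendsto_of_real_iff)
  then show ?thesis by (simp add: sums_def AB)
qed

section \<open>Haar averages on SO(3)\<close>

lemma borel_measurable_matrix_vector_mult [measurable (raw)]: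
  fixes A :: "'a \<Rightarrow> real^'n^'m" and x :: "'a \<Rightarrow> real^'n"
  assumes "A \<in> borel_measurable M" "x \<in> borel_measurable M"
  shows "(\<lambda>w. A w *v x w) \<in> borel_measurable M"
  using assms
  by (rule borel_measurable_continuous_Pair)
    (auto simp: matrix_vector_mult_def intro!: continuous_intros)

lemma borel_measurable_matrix_matrix_mult [measurable (raw)]:
  fixes A :: "'a \<Rightarrow> real^'n^'m" and B :: "'a \<Rightarrow> real^'k^'n"
  assumes "A \<in> borel_measurable M" "B \<in> borel_measurable M"
  shows "(\<lambda>w. A w ** B w) \<in> borel_measurable M"
  using assms
  by (rule borel_measurable_continuous_Pair)
    (auto simp: matrix_matrix_mult_def intro!: continuous_intros)

lemma borel_measurable_transpose [measurable (raw)]: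
  fixes A :: "'a \<Rightarrow> real^'n^'m"
  assumes "A \<in> borel_measurable M"
  shows "(\<lambda>w. transpose (A w)) \<in> borel_measurable M"
  using assms
  by (rule borel_measurable_continuous_on[rotated])
    (auto simp: transpose_def intro!: continuous_intros)

lemma borel_measurable_cnj [measurable (raw)]:
  assumes "f \<in> borel_measurable M"
  shows "(\<lambda>w. cnj (f w)) \<in> borel_measurable M"
  using assms by (rule borel_measurable_continuous_on[rotated]) (intro continuous_intros)

lemma inner_matrix_vector_left: "(A *v x) \<bullet> y = x \<bullet> (transpose A *v y)" for A :: "real^'n^'m"
  by (metis dot_lmul_matrix inner_commute transpose_matrix_vector)

lemma SO3_transpose: "U \<in> SO3 \<Longrightarrow> transpose U \<in> SO3"
  by (auto simp: SO3_def det_transpose)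

lemma SO3_inner:
  assumes "U \<in> SO3"
  shows "(U *v x) \<bullet> (U *v y) = x \<bullet> y"
proof -
  have "(U *v x) \<bullet> (U *v y) = x \<bullet> (transpose U *v (U *v y))"
    by (rule inner_matrix_vector_left)
  also have "\<dots> = x \<bullet> y"
    using assms by (simp add: SO3_def orthogonal_matrix_def matrix_vector_mul_assoc)
  finally show ?thesis .
qed

lemma SO3_norm [simp]: "U \<in> SO3 \<Longrightarrow> norm (U *v x) = norm x"
  by (simp add: norm_eq_sqrt_inner SO3_inner)

lemma SO3_transitive:
  assumes "norm x = norm y"
  obtains U where "U \<in> SO3" "U *v x = y"
proof -
  obtain f :: "real^3 \<Rightarrow> real^3" where f: "orthogonal_transformation f" "det (matrix f) = 1" "f x = y"
    using rotation_exists[OF _ assms] by auto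
  show ?thesis
    by (rule that[of "matrix f"])
      (use f in \<open>auto simp: SO3_def orthogonal_transformation_matrix matrix_works\<close>)
qed

definition rotation3 :: "real \<Rightarrow> real^3^3" where
  "rotation3 \<theta> = vector [vector [cos \<theta>, - sin \<theta>, 0], vector [sin \<theta>, cos \<theta>, 0], vector [0, 0, 1]]"

lemma rotation3_nth:
  "(rotation3 \<theta> *v x) $ 1 = cos \<theta> * x $ 1 - sin \<theta> * x $ 2"
  "(rotation3 \<theta> *v x) $ 2 = sin \<theta> * x $ 1 + cos \<theta> * x $ 2"
  "(rotation3 \<theta> *v x) $ 3 = x $ 3"
  by (simp_all add: rotation3_def matrix_vector_mult_def sum_3)

lemma rotation3_SO3: "rotation3 \<theta> \<in> SO3"
proof -
  have "cos \<theta> * cos \<theta> + sin \<theta> * sin \<theta> = 1"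
    by (metis sin_cos_squared_add2 power2_eq_square sin_cos_squared_add3)
  then show ?thesis
    by (simp add: SO3_def orthogonal_matrix rotation3_def matrix_matrix_mult_def transpose_def mat_def
      vec_eq_iff forall_3 sum_3 det_3 algebra_simps)
qed

lemma rotation3_axis: "rotation3 \<theta> *v (c *\<^sub>R axis 3 1) = c *\<^sub>R axis 3 1"
  by (simp add: vec_eq_iff forall_3 rotation3_nth axis_def)

text \<open>Bilinear pairing of \<open>x\<close> with the complex vector \<open>u + i v\<close>, which is null iff \<open>u \<bullet> v = 0\<close> and \<open>|u| = |v|\<close>.\<close>
definition null_pairing :: "real^3 \<Rightarrow> real^3 \<Rightarrow> real^3 \<Rightarrow> complex" where
  "null_pairing u v x = Complex (u \<bullet> x) (v \<bullet> x)"

text \<open>Along the orbit of \<open>y\<close> under rotations about the third axis the pairing is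
  a trigonometric polynomial of degree one. Nullity makes the product of its two outer coefficients
  equal to \<open>e_3^2 * (y_3^2 - |y|^2) / 4\<close>, exactly the quantity in Laplace's
  coefficients.\<close>

lemma null_pairing_average:
  fixes u v y :: "real^3"
  assumes "u \<bullet> v = 0" "u \<bullet> u = v \<bullet> v" "l < N"
  shows "(\<Sum>n<N. null_pairing u v (rotation3 (2*pi*real n/real N) *v y) ^ l) / of_nat N
    = null_pairing u v (axis 3 1) ^ l * of_real (legendre_form l (y $ 3) (y \<bullet> y))"
proof -
  define e where "e = (\<lambda>k. Complex (u $ k) (v $ k))"
  \<comment> \<open>\<beta> and \<gamma> are the coefficients of \<open>cos \<theta>\<close> and
    \<open>sin \<theta>\<close> in the pairing with the rotated \<open>y\<close>.\<close>
  define \<beta> where "\<beta> = e 1 * of_real (y $ 1) + e 2 * of_real (y $ 2)"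
  define \<gamma> where "\<gamma> = e 2 * of_real (y $ 1) - e 1 * of_real (y $ 2)"
  have null: "e 1 ^ 2 + e 2 ^ 2 = - (e 3 ^ 2)"
    using assms(1,2) by (simp add: e_def complex_eq_iff power2_eq_square inner_vec_def sum_3)
  have "\<beta>\<^sup>2 + \<gamma>\<^sup>2 = (e 1 ^ 2 + e 2 ^ 2) * of_real ((y $ 1)\<^sup>2 + (y $ 2)\<^sup>2)"
    by (simp add: \<beta>_def \<gamma>_def power2_eq_square algebra_simps)
  also have "\<dots> = e 3 ^ 2 * ((of_real (y $ 3))\<^sup>2 - of_real (y \<bullet> y))"
    unfolding null by (simp add: inner_vec_def sum_3 power2_eq_square algebra_simps)
  finally have "(\<beta>\<^sup>2 + \<gamma>\<^sup>2) / 4 = e 3 ^ 2 * ((of_real (y $ 3))\<^sup>2 - of_real (y \<bullet> y)) / 4" by simp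
  moreover have "(\<beta> - \<i> * \<gamma>) / 2 * ((\<beta> + \<i> * \<gamma>) / 2) = (\<beta>\<^sup>2 + \<gamma>\<^sup>2) / 4"
    by (simp add: power2_eq_square algebra_simps)
  ultimately have bg: "(\<beta> - \<i> * \<gamma>) / 2 * ((\<beta> + \<i> * \<gamma>) / 2) = e 3 ^ 2 * ((of_real (y $ 3))\<^sup>2 - of_real (y \<bullet> y)) / 4"
    by simp
  have e3: "null_pairing u v (axis 3 1) = e 3"
    by (simp add: null_pairing_def e_def inner_axis)
  have node: "null_pairing u v (rotation3 \<theta> *v y) = e 3 * of_real (y $ 3) + (\<beta> - \<i> * \<gamma>) / 2 * cis \<theta> + (\<beta> + \<i> * \<gamma>) / 2 * cis (- \<theta>)" for \<theta>
    by (simp add: null_pairing_def inner_vec_def sum_3 rotation3_nth e_def \<beta>_def \<gamma>_def complex_eq_iff field_simps)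
  have "(\<Sum>n<N. null_pairing u v (rotation3 (2*pi*real n/real N) *v y) ^ l) / of_nat N
    = (\<Sum>j\<le>l. of_nat ((l choose (2*j)) * ((2*j) choose j)) * (e 3 * of_real (y $ 3))^(l - 2*j) * (e 3 ^ 2 * ((of_real (y $ 3))\<^sup>2 - of_real (y \<bullet> y)) / 4)^j)"
    unfolding node roots_average_power[OF assms(3)] bg ..
  also have "\<dots> = legendre_form l (e 3 * of_real (y $ 3)) ((e 3)\<^sup>2 * of_real (y \<bullet> y))"
    unfolding legendre_form_def by (simp add: power_mult_distrib right_diff_distrib)
  finally show ?thesis unfolding legendre_form_homogeneous legendre_form_of_real e3 .
qed

section \<open>Haar integrals of powers of null pairings\<close>

lemma haar_prob_space: "haar_SO3 H \<Longrightarrow> prob_space H"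
  by (simp add: haar_SO3_def)

lemma haar_sets: "haar_SO3 H \<Longrightarrow> sets H = sets borel"
  by (simp add: haar_SO3_def)

lemma haar_measurable: "haar_SO3 H \<Longrightarrow> f \<in> borel_measurable borel \<Longrightarrow> f \<in> borel_measurable H"
  by (simp add: haar_sets cong: measurable_cong_sets)

lemma haar_AE_SO3:
  assumes "haar_SO3 H"
  shows "AE U in H. U \<in> SO3"
proof -
  interpret prob_space H using assms by (rule haar_prob_space)
  have "prob SO3 = 1" using assms by (simp add: haar_SO3_def measure_def)
  then show ?thesis by (rule AE_prob_1)
qed

lemma haar_integral_mult:
  fixes f :: "real^3^3 \<Rightarrow> 'b::{banach,second_countable_topology}"
  assumes "haar_SO3 H" "V \<in> SO3" and [measurable]: "f \<in> borel_measurable borel"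
  shows "(\<integral>U. f (V ** U) \<partial>H) = (\<integral>U. f U \<partial>H)"
proof -
  note haar_sets[OF assms(1), measurable_cong]
  have "(\<integral>U. f U \<partial>H) = (\<integral>U. f U \<partial>distr H borel (\<lambda>U. V ** U))"
    using assms(1,2) by (simp add: haar_SO3_def)
  also have "\<dots> = (\<integral>U. f (V ** U) \<partial>H)" 
    using borel_measurable_matrix_matrix_mult[of "\<lambda>_. V" borel "\<lambda>U. U"]
    by (subst integral_distr) (auto intro!: haar_measurable[OF assms(1)])
  finally show ?thesis ..
qed

lemma haar_integrable_bounded:
  fixes f :: "real^3^3 \<Rightarrow> 'b::{banach,second_countable_topology}"
  assumes "haar_SO3 H" and "f \<in> borel_measurable borel" and "\<And>U. U \<in> SO3 \<Longrightarrow> norm (f U) \<le> B"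
  shows "integrable H f"
proof -
  interpret prob_space H using assms(1) by (rule haar_prob_space)
  note haar_sets[OF assms(1), measurable_cong]
  show ?thesis
    by (rule integrable_const_bound[where B=B])
      (use haar_AE_SO3[OF assms(1)] haar_measurable[OF assms(1)] assms in \<open>auto elim!: eventually_mono\<close>)
qed

text \<open>The pairing of \<open>x\<close> with the rotated null vector
  \<open>U (e_1 + i e_2)\<close>. Its \<open>l\<close>-th powers, indexed by \<open>U\<close>, are
  harmonic polynomials and stand in for the spherical harmonics of degree \<open>l\<close>.\<close>

definition rotated_null :: "real^3^3 \<Rightarrow> real^3 \<Rightarrow> complex" where
  "rotated_null U x = null_pairing (U *v axis 1 1) (U *v axis 2 1) x"

lemma borel_measurable_rotated_null [measurable (raw)]:
  assumes [measurable]: "U \<in> borel_measurable M" "x \<in> borel_measurable M"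
  shows "(\<lambda>w. rotated_null (U w) (x w)) \<in> borel_measurable M"
proof -
  have "(\<lambda>w. complex_of_real ((U w *v axis 1 1) \<bullet> x w) + \<i> * of_real ((U w *v axis 2 1) \<bullet> x w)) \<in> borel_measurable M"
    by measurable
  then show ?thesis
    by (simp add: rotated_null_def null_pairing_def complex_eq_iff Complex_eq)
qed

lemma rotated_null_SO3: "V \<in> SO3 \<Longrightarrow> rotated_null (V ** U) (V *v x) = rotated_null U x"
  by (simp add: rotated_null_def null_pairing_def SO3_inner flip: matrix_vector_mul_assoc)

lemma rotated_null_scaleR: "rotated_null U (c *\<^sub>R x) = of_real c * rotated_null U x"
  by (simp add: rotated_null_def null_pairing_def complex_eq_iff)

lemma cmod_rotated_null_le: 
  assumes "U \<in> SO3"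
  shows "cmod (rotated_null U x) \<le> 2 * norm x"
proof -
  have "cmod (rotated_null U x) \<le> \<bar>(U *v axis 1 1) \<bullet> x\<bar> + \<bar>(U *v axis 2 1) \<bullet> x\<bar>"
    using cmod_le[of "rotated_null U x"] by (simp add: rotated_null_def null_pairing_def)
  also have "\<dots> \<le> norm (U *v axis 1 (1::real)) * norm x + norm (U *v axis 2 (1::real)) * norm x"
    by (intro add_mono Cauchy_Schwarz_ineq2)
  finally show ?thesis using assms by (simp add: norm_axis_1)
qed

lemma cmod_rotated_null_prod_le:
  assumes "U \<in> SO3"
  shows "cmod (rotated_null U x ^ l * cnj (rotated_null U y ^ l)) \<le> (2 * norm x)^l * (2 * norm y)^l"
  unfolding norm_mult complex_mod_cnj norm_power
  by (intro mult_mono power_mono cmod_rotated_null_le assms) auto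

lemma rotated_null_average:
  assumes "U \<in> SO3" "l < N"
  shows "(\<Sum>n<N. rotated_null U (rotation3 (2*pi*real n/real N) *v y) ^ l) / of_nat N
    = rotated_null U (axis 3 1) ^ l * of_real (legendre_form l (y $ 3) (y \<bullet> y))"
  unfolding rotated_null_def using assms
  by (intro null_pairing_average) (auto simp: SO3_inner inner_axis_axis)

text \<open>The normalization of the addition theorem, read off with both arguments at the
  pole.\<close>

definition haar_const :: "(real^3^3) measure \<Rightarrow> nat \<Rightarrow> real" where
  "haar_const H l = (\<integral>U. (cmod (rotated_null U (axis 3 1)))^(2*l) \<partial>H)"

lemma haar_rotated_null_integrable:
  assumes "haar_SO3 H"
  shows "integrable H (\<lambda>U. rotated_null U x ^ l * cnj (rotated_null U y ^ l))"
  using assms by (rule haar_integrable_bounded[OF _ _ cmod_rotated_null_prod_le]) auto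

lemma haar_rotated_null_invariant:
  assumes "haar_SO3 H" "V \<in> SO3"
  shows "(\<integral>U. rotated_null U (V *v x) ^ l * cnj (rotated_null U (V *v y) ^ l) \<partial>H)
    = (\<integral>U. rotated_null U x ^ l * cnj (rotated_null U y ^ l) \<partial>H)"
  using haar_integral_mult[OF assms, of "\<lambda>U. rotated_null U (V *v x) ^ l * cnj (rotated_null U (V *v y) ^ l)"]
  by (simp add: rotated_null_SO3[OF assms(2)])

text \<open>The left-hand side is invariant under a common rotation of \<open>x\<close> and
  \<open>y\<close>, so \<open>x\<close> may be placed on the third axis. Rotations about that axis
  then act on \<open>y\<close> alone, and averaging over them turns the factor in \<open>y\<close>
  into a Legendre polynomial.\<close>

lemma haar_addition_theorem:
  assumes H: "haar_SO3 H"
  shows "(\<integral>U. rotated_null U x ^ l * cnj (rotated_null U y ^ l) \<partial>H)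
    = of_real (haar_const H l * legendre_form l (x \<bullet> y) ((x \<bullet> x) * (y \<bullet> y)))"
proof -
  note haar_sets[OF H, measurable_cong]
  define G where "G = (\<lambda>x y. \<integral>U. rotated_null U x ^ l * cnj (rotated_null U y ^ l) \<partial>H)"
  let ?R = "\<lambda>n. rotation3 (2*pi*real n/real (Suc l))"
  have pole: "G (a *\<^sub>R axis 3 1) y = of_real (a ^ l * haar_const H l * legendre_form l (y $ 3) (y \<bullet> y))" for a y
  proof -
    have "G (a *\<^sub>R axis 3 1) y = G (a *\<^sub>R axis 3 1) (?R n *v y)" for n
      using haar_rotated_null_invariant[OF H rotation3_SO3, of "2*pi*real n/real (Suc l)" "a *\<^sub>R axis 3 1" l y]
      by (simp add: G_def rotation3_axis)
    then have "G (a *\<^sub>R axis 3 1) y = (\<Sum>n<Suc l. G (a *\<^sub>R axis 3 1) (?R n *v y)) / of_nat (Suc l)"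
      by (simp del: sum.lessThan_Suc of_nat_Suc)
    also have "\<dots> = (\<integral>U. (\<Sum>n<Suc l. rotated_null U (a *\<^sub>R axis 3 1) ^ l * cnj (rotated_null U (?R n *v y) ^ l)) / of_nat (Suc l) \<partial>H)"
      unfolding G_def
      by (subst Bochner_Integration.integral_sum[symmetric]) (auto intro!: haar_rotated_null_integrable[OF H] simp del: sum.lessThan_Suc of_nat_Suc complex_cnj_power)
    also have "\<dots> = (\<integral>U. of_real (a ^ l * (cmod (rotated_null U (axis 3 1)))^(2*l) * legendre_form l (y $ 3) (y \<bullet> y)) \<partial>H)"
    proof (rule integral_cong_AE)
      show "AE U in H. (\<Sum>n<Suc l. rotated_null U (a *\<^sub>R axis 3 1) ^ l * cnj (rotated_null U (?R n *v y) ^ l)) / of_nat (Suc l)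
        = of_real (a ^ l * (cmod (rotated_null U (axis 3 1)))^(2*l) * legendre_form l (y $ 3) (y \<bullet> y))"
        using haar_AE_SO3[OF H]
      proof eventually_elim
        case (elim U)
        let ?z = "rotated_null U (axis 3 1)"
        have "(\<Sum>n<Suc l. rotated_null U (a *\<^sub>R axis 3 1) ^ l * cnj (rotated_null U (?R n *v y) ^ l)) / of_nat (Suc l)
          = rotated_null U (a *\<^sub>R axis 3 1) ^ l * cnj ((\<Sum>n<Suc l. rotated_null U (?R n *v y) ^ l) / of_nat (Suc l))"
          unfolding sum_distrib_left[symmetric] complex_cnj_divide cnj_sum complex_cnj_of_nat by (simp only: times_divide_eq_right)
        also have "\<dots> = (of_real a * ?z) ^ l * cnj (?z ^ l * of_real (legendre_form l (y $ 3) (y \<bullet> y)))"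
          unfolding rotated_null_average[OF elim lessI] rotated_null_scaleR ..
        also have "\<dots> = of_real (a ^ l * legendre_form l (y $ 3) (y \<bullet> y)) * (?z * cnj ?z) ^ l"
          by (simp add: power_mult_distrib)
        also have "?z * cnj ?z = of_real ((cmod ?z)\<^sup>2)" by (rule complex_norm_square[symmetric])
        finally show ?case unfolding power_mult[of _ 2 l] by (simp only: of_real_mult of_real_power mult_ac)
      qed
    qed (rule haar_measurable[OF H], measurable)+
    also have "\<dots> = of_real (a ^ l * haar_const H l * legendre_form l (y $ 3) (y \<bullet> y))"
      by (simp only: integral_complex_of_real haar_const_def integral_mult_left_zero integral_mult_right_zero)
    finally show ?thesis .
  qed
  obtain V where V: "V \<in> SO3" "V *v x = norm x *\<^sub>R axis 3 1"
    by (rule SO3_transitive[of x "norm x *\<^sub>R axis 3 1"]) (auto simp: norm_axis_1)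
  have "G x y = G (norm x *\<^sub>R axis 3 1) (V *v y)"
    using haar_rotated_null_invariant[OF H V(1), of x l y] by (simp add: G_def V(2))
  also have "\<dots> = of_real (haar_const H l * ((norm x) ^ l * legendre_form l ((V *v y) $ 3) (y \<bullet> y)))"
    unfolding pole by (simp add: SO3_inner[OF V(1)])
  also have "(norm x) ^ l * legendre_form l ((V *v y) $ 3) (y \<bullet> y) = legendre_form l (x \<bullet> y) ((x \<bullet> x) * (y \<bullet> y))"
  proof -
    have "x \<bullet> y = (V *v x) \<bullet> (V *v y)" by (simp add: SO3_inner[OF V(1)])
    also have "\<dots> = norm x * (V *v y) $ 3" by (simp add: V(2) inner_axis inner_commute)
    finally show ?thesis unfolding legendre_form_homogeneous[symmetric] by (simp add: power2_norm_eq_inner)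
  qed
  finally show ?thesis by (simp add: G_def)
qed

text \<open>If the constant vanished, the addition theorem on the diagonal would make
  \<open>rotated_null U x ^ l\<close> zero for almost every \<open>U\<close>, whatever
  \<open>x\<close> is; but \<open>U (e_1 + i e_2)\<close> cannot vanish.\<close>

lemma haar_const_pos:
  assumes H: "haar_SO3 H"
  shows "haar_const H l > 0"
proof (rule ccontr)
  interpret prob_space H using H by (rule haar_prob_space)
  note haar_sets[OF H, measurable_cong]
  assume "\<not> haar_const H l > 0"
  moreover have "haar_const H l \<ge> 0" unfolding haar_const_def by (rule integral_nonneg_AE) auto
  ultimately have c0: "haar_const H l = 0" by simp
  have "AE U in H. rotated_null U x ^ l = 0" for x
  proof -
    have "(\<integral>U. rotated_null U x ^ l * cnj (rotated_null U x ^ l) \<partial>H) = 0"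
      by (simp only: haar_addition_theorem[OF H] c0) simp
    moreover have "rotated_null U x ^ l * cnj (rotated_null U x ^ l) = of_real ((cmod (rotated_null U x ^ l))\<^sup>2)" for U
      by (simp only: complex_norm_square)
    ultimately have 0: "(\<integral>U. (cmod (rotated_null U x ^ l))\<^sup>2 \<partial>H) = 0"
      by (simp only: integral_complex_of_real of_real_eq_0_iff)
    have "integrable H (\<lambda>U. (cmod (rotated_null U x ^ l))\<^sup>2)"
    proof (rule haar_integrable_bounded[OF H, of _ "((2 * norm x) ^ l)\<^sup>2"])
      fix U :: "real^3^3" assume "U \<in> SO3"
      then show "norm ((cmod (rotated_null U x ^ l))\<^sup>2) \<le> ((2 * norm x) ^ l)\<^sup>2"
        unfolding real_norm_def abs_power2 norm_power by (intro power_mono cmod_rotated_null_le) auto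
    qed measurable
    then have "AE U in H. (cmod (rotated_null U x ^ l))\<^sup>2 = 0"
      using 0 by (subst (asm) integral_nonneg_eq_0_iff_AE) auto
    then show ?thesis by (rule eventually_mono) simp
  qed
  \<comment> \<open>The exceptional null set depends on \<open>x\<close>; three coordinate vectors
    are enough to determine the null vector.\<close>
  then have "AE U in H. \<forall>k\<in>UNIV. rotated_null U (axis k 1) ^ l = 0"
    by (intro AE_finite_allI) auto
  then have "AE U in H. False"
    using haar_AE_SO3[OF H]
  proof eventually_elim
    case (elim U)
    then have "rotated_null U (axis k 1) = 0" for k by simp
    then have "(U *v axis 1 1) $ k = 0" for k
      by (simp add: rotated_null_def null_pairing_def complex_eq_iff inner_axis)
    then have "U *v axis 1 1 = 0" by (simp add: vec_eq_iff)
    then show ?case using SO3_norm[OF elim(2), of "axis 1 1"] by (simp add: norm_axis_1)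
  qed
  then show False by simp
qed

text \<open>The azimuthal mean of \<open>P_l\<close> of the angle between two vectors is the product
  of the values at their latitudes. Passing to null pairings, the mean acts on one factor only, and
  the addition theorem at the pole evaluates the rest; the positive \<open>haar_const H l\<close>
  cancels.\<close>

lemma legendre_form_product_formula:
  assumes H: "haar_SO3 H" and "l < N"
  shows "(\<Sum>n<N. legendre_form l ((rotation3 (2*pi*real n/real N) *v x) \<bullet> y) ((x \<bullet> x) * (y \<bullet> y))) / real N
    = legendre_form l (x $ 3) (x \<bullet> x) * legendre_form l (y $ 3) (y \<bullet> y)"
proof -
  note haar_sets[OF H, measurable_cong]
  let ?R = "\<lambda>n. rotation3 (2*pi*real n/real N)"
  let ?c = "haar_const H l"
  have "complex_of_real (?c * ((\<Sum>n<N. legendre_form l ((?R n *v x) \<bullet> y) ((x \<bullet> x) * (y \<bullet> y))) / real N))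
    = (\<Sum>n<N. \<integral>U. rotated_null U (?R n *v x) ^ l * cnj (rotated_null U y ^ l) \<partial>H) / of_nat N"
    unfolding haar_addition_theorem[OF H] SO3_inner[OF rotation3_SO3]
    by (simp add: sum_distrib_left)
  also have "\<dots> = (\<integral>U. (\<Sum>n<N. rotated_null U (?R n *v x) ^ l * cnj (rotated_null U y ^ l)) / of_nat N \<partial>H)"
    by (subst Bochner_Integration.integral_sum[symmetric]) (auto intro!: haar_rotated_null_integrable[OF H] simp del: complex_cnj_power)
  also have "\<dots> = (\<integral>U. of_real (legendre_form l (x $ 3) (x \<bullet> x)) * (rotated_null U (axis 3 1) ^ l * cnj (rotated_null U y ^ l)) \<partial>H)"
  proof (rule integral_cong_AE)
    show "AE U in H. (\<Sum>n<N. rotated_null U (?R n *v x) ^ l * cnj (rotated_null U y ^ l)) / of_nat N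
       = of_real (legendre_form l (x $ 3) (x \<bullet> x)) * (rotated_null U (axis 3 1) ^ l * cnj (rotated_null U y ^ l))"
      using haar_AE_SO3[OF H]
    proof eventually_elim
      case (elim U)
      have "(\<Sum>n<N. rotated_null U (?R n *v x) ^ l * cnj (rotated_null U y ^ l)) / of_nat N
        = (\<Sum>n<N. rotated_null U (?R n *v x) ^ l) / of_nat N * cnj (rotated_null U y ^ l)"
        unfolding sum_distrib_right[symmetric] by simp
      then show ?case unfolding rotated_null_average[OF elim assms(2)] by (simp add: mult_ac)
    qed
  qed (rule haar_measurable[OF H], measurable)+
  also have "\<dots> = of_real (legendre_form l (x $ 3) (x \<bullet> x)) * of_real (?c * legendre_form l (y $ 3) (y \<bullet> y))"
    unfolding integral_mult_right_zero haar_addition_theorem[OF H] by (simp add: inner_axis inner_axis' )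
  finally have "?c * ((\<Sum>n<N. legendre_form l ((?R n *v x) \<bullet> y) ((x \<bullet> x) * (y \<bullet> y))) / real N)
    = ?c * (legendre_form l (x $ 3) (x \<bullet> x) * legendre_form l (y $ 3) (y \<bullet> y))"
    unfolding of_real_mult[symmetric] of_real_eq_iff by (simp only: mult_ac)
  then show ?thesis using haar_const_pos[OF H, of l] by (metis less_irrefl mult_left_cancel)
qed

lemma legendre_form_measurable [measurable (raw)]:
  fixes t q :: "'a \<Rightarrow> real"
  assumes [measurable]: "t \<in> borel_measurable M" "q \<in> borel_measurable M"
  shows "(\<lambda>w. legendre_form l (t w) (q w)) \<in> borel_measurable M"
  unfolding legendre_form_def by measurable

lemma abs_legendre_form_inner_le:
  fixes x y :: "'a::real_inner"
  shows "\<bar>legendre_form l (x \<bullet> y) ((x \<bullet> x) * (y \<bullet> y))\<bar> \<le> (norm x * norm y) ^ l"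
proof -
  have "sqrt ((x \<bullet> x) * (y \<bullet> y)) = norm x * norm y" by (simp add: real_sqrt_mult norm_eq_sqrt_inner)
  then show ?thesis
    using abs_legendre_form_le[of "x \<bullet> y" "(x \<bullet> x) * (y \<bullet> y)" l] Cauchy_Schwarz_ineq[of x y] by simp
qed

text \<open>As a function of \<open>x\<close> the mean is rotation invariant, while averaging over rotations about an axis multiplies
  it by \<open>P_l(x\<^sub>3)\<close>, which is not constant.\<close>
lemma haar_legendre_form_mean:
  assumes H: "haar_SO3 H" and l: "l \<ge> 1"
  shows "(\<integral>V. legendre_form l (x \<bullet> (V *v y)) ((x \<bullet> x) * (y \<bullet> y)) \<partial>H) = 0"
proof -
  note haar_sets[OF H, measurable_cong]
  define m where "m = (\<lambda>x. \<integral>V. legendre_form l (x \<bullet> (V *v y)) ((x \<bullet> x) * (y \<bullet> y)) \<partial>H)"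
  have inv: "m (W *v x) = m x" if W: "W \<in> SO3" for W x
  proof -
    have "(W *v x) \<bullet> (V *v y) = x \<bullet> ((transpose W ** V) *v y)" for V
      by (simp add: inner_matrix_vector_left flip: matrix_vector_mul_assoc)
    then have "m (W *v x) = (\<integral>V. legendre_form l (x \<bullet> ((transpose W ** V) *v y)) ((x \<bullet> x) * (y \<bullet> y)) \<partial>H)"
      by (simp add: m_def SO3_inner[OF W])
    also have "\<dots> = m x" unfolding m_def
      by (rule haar_integral_mult[OF H SO3_transpose[OF W], of "\<lambda>V. legendre_form l (x \<bullet> (V *v y)) ((x \<bullet> x) * (y \<bullet> y))"]) measurable
    finally show ?thesis .
  qed
  have int: "integrable H (\<lambda>V. legendre_form l (x \<bullet> (V *v y)) ((x \<bullet> x) * (y \<bullet> y)))" for x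
  proof (rule haar_integrable_bounded[OF H])
    fix U :: "real^3^3" assume U: "U \<in> SO3"
    show "norm (legendre_form l (x \<bullet> (U *v y)) ((x \<bullet> x) * (y \<bullet> y))) \<le> (norm x * norm y) ^ l"
      using abs_legendre_form_inner_le[of l x "U *v y"] U by (simp add: SO3_inner)
  qed measurable
  let ?R = "\<lambda>n. rotation3 (2*pi*real n/real (Suc l))"
  have m: "m x = legendre_form l (x $ 3) (x \<bullet> x) * m (axis 3 1)" for x
  proof -
    have "m x = (\<Sum>n<Suc l. m (?R n *v x)) / real (Suc l)"
      by (simp add: inv[OF rotation3_SO3] del: sum.lessThan_Suc of_nat_Suc)
    also have "\<dots> = (\<integral>V. (\<Sum>n<Suc l. legendre_form l ((?R n *v x) \<bullet> (V *v y)) ((?R n *v x) \<bullet> (?R n *v x) * (y \<bullet> y))) / real (Suc l) \<partial>H)"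
      unfolding m_def
      by (subst Bochner_Integration.integral_sum[symmetric]) (auto intro!: int simp del: sum.lessThan_Suc of_nat_Suc)
    also have "\<dots> = (\<integral>V. legendre_form l (x $ 3) (x \<bullet> x) * legendre_form l (axis 3 1 \<bullet> (V *v y)) ((axis 3 1 \<bullet> (axis 3 1::real^3)) * (y \<bullet> y)) \<partial>H)"
    proof (rule integral_cong_AE)
      show "AE V in H. (\<Sum>n<Suc l. legendre_form l ((?R n *v x) \<bullet> (V *v y)) ((?R n *v x) \<bullet> (?R n *v x) * (y \<bullet> y))) / real (Suc l)
        = legendre_form l (x $ 3) (x \<bullet> x) * legendre_form l (axis 3 1 \<bullet> (V *v y)) ((axis 3 1 \<bullet> (axis 3 1::real^3)) * (y \<bullet> y))"
        using haar_AE_SO3[OF H]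
      proof eventually_elim
        case (elim V)
        show ?case
          using legendre_form_product_formula[OF H lessI, of l x "V *v y"]
          by (simp add: SO3_inner[OF rotation3_SO3] SO3_inner[OF elim] inner_axis_axis inner_axis' del: sum.lessThan_Suc of_nat_Suc)
      qed
    qed (rule haar_measurable[OF H], measurable)+
    also have "\<dots> = legendre_form l (x $ 3) (x \<bullet> x) * m (axis 3 1)"
      by (simp add: m_def)
    finally show ?thesis .
  qed
  \<comment> \<open>The pole is compared with a point of the equator, where the multiplier of the
    mean is \<open>P_l(0)\<close>.\<close>
  obtain W where W: "W \<in> SO3" "W *v axis 3 1 = axis 1 1"
    by (rule SO3_transitive[of "axis 3 1" "axis 1 1"]) (auto simp: norm_axis_1)
  have "m (axis 3 1) = m (axis 1 1)" using inv[OF W(1), of "axis 3 1"] W(2) by simp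
  also have "\<dots> = legendre_form l 0 1 * m (axis 3 1)"
    by (subst m) (simp add: inner_axis_axis, simp add: axis_def)
  finally have "m (axis 3 1) = 0" using legendre_form_0_1_neq_1[OF l] by simp
  then show ?thesis using m[of x] by (simp add: m_def)
qed

section \<open>Positive definite kernels\<close>

text \<open>After exchanging the integrals the inner one is
  \<open>|\<integral> \<psi>_q dM|^2\<close>. The finiteness hypothesis is the absolute
  integrability that Fubini requires.\<close>

lemma integral_feature_product_nonneg:
  fixes \<psi> :: "'q \<Rightarrow> 'a \<Rightarrow> complex"
  assumes "sigma_finite_measure M" "sigma_finite_measure Q"
    and [measurable]: "case_prod \<psi> \<in> borel_measurable (Q \<Otimes>\<^sub>M M)"
    and fin: "(\<integral>\<^sup>+ z. (\<integral>\<^sup>+ q. ennreal (cmod (\<psi> q (fst z)) * cmod (\<psi> q (snd z))) \<partial>Q) \<partial>(M \<Otimes>\<^sub>M M)) < \<infinity>"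
  shows "0 \<le> Re (\<integral>z. (\<integral>q. \<psi> q (fst z) * cnj (\<psi> q (snd z)) \<partial>Q) \<partial>(M \<Otimes>\<^sub>M M))"
proof -
  interpret M: sigma_finite_measure M by fact
  interpret Q: sigma_finite_measure Q by fact
  interpret MM: pair_sigma_finite M M ..
  interpret ZQ: pair_sigma_finite "M \<Otimes>\<^sub>M M" Q ..
  let ?F = "\<lambda>z q. \<psi> q (fst z) * cnj (\<psi> q (snd z))"
  have int: "integrable ((M \<Otimes>\<^sub>M M) \<Otimes>\<^sub>M Q) (case_prod ?F)"
    unfolding integrable_iff_bounded
  proof
    show "case_prod ?F \<in> borel_measurable ((M \<Otimes>\<^sub>M M) \<Otimes>\<^sub>M Q)" by measurable
    have "(\<integral>\<^sup>+ zq. ennreal (norm (case_prod ?F zq)) \<partial>((M \<Otimes>\<^sub>M M) \<Otimes>\<^sub>M Q)) = (\<integral>\<^sup>+ z. (\<integral>\<^sup>+ q. ennreal (cmod (\<psi> q (fst z)) * cmod (\<psi> q (snd z))) \<partial>Q) \<partial>(M \<Otimes>\<^sub>M M))"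
      by (subst Q.nn_integral_fst[symmetric]) (auto simp: norm_mult)
    then show "(\<integral>\<^sup>+ zq. ennreal (norm (case_prod ?F zq)) \<partial>((M \<Otimes>\<^sub>M M) \<Otimes>\<^sub>M Q)) < \<infinity>" using fin by simp
  qed
  have "(\<integral>z. (\<integral>q. ?F z q \<partial>Q) \<partial>(M \<Otimes>\<^sub>M M)) = (\<integral>q. (\<integral>z. ?F z q \<partial>(M \<Otimes>\<^sub>M M)) \<partial>Q)"
    using ZQ.Fubini_integral[OF int] by simp
  moreover have "Re (\<integral>q. (\<integral>z. ?F z q \<partial>(M \<Otimes>\<^sub>M M)) \<partial>Q) = (\<integral>q. Re (\<integral>z. ?F z q \<partial>(M \<Otimes>\<^sub>M M)) \<partial>Q)"
    using ZQ.integrable_snd[OF int] by simp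
  moreover have "\<dots> \<ge> 0"
  proof (rule integral_nonneg_AE)
    show "AE q in Q. 0 \<le> Re (\<integral>z. ?F z q \<partial>(M \<Otimes>\<^sub>M M))"
      using ZQ.AE_integrable_snd[OF int]
    proof eventually_elim
      case (elim q)
      have "(\<integral>z. ?F z q \<partial>(M \<Otimes>\<^sub>M M)) = (\<integral>x. (\<integral>y. \<psi> q x * cnj (\<psi> q y) \<partial>M) \<partial>M)"
        using MM.integral_fst'[OF elim] by simp
      also have "\<dots> = (\<integral>x. \<psi> q x \<partial>M) * cnj (\<integral>x. \<psi> q x \<partial>M)"
        by simp
      also have "\<dots> = of_real ((cmod (\<integral>x. \<psi> q x \<partial>M))\<^sup>2)" by (rule complex_norm_square[symmetric])
      finally show ?case by simp
    qed
  qed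
  ultimately show ?thesis by simp
qed

section \<open>Powers of a minimum as layer cakes\<close>

lemma rpow_nonneg [simp]: "0 \<le> r \<Longrightarrow> 0 \<le> rpow r a"
  by (simp add: rpow_def)

lemma rpow_mono: "0 \<le> a \<Longrightarrow> 0 \<le> r \<Longrightarrow> r \<le> t \<Longrightarrow> rpow r a \<le> rpow t a"
  by (simp add: rpow_def powr_mono2)

lemma rpow_eq_powr: "0 < r \<Longrightarrow> rpow r a = r powr a"
  by (simp add: rpow_def)

lemma borel_measurable_rpow [measurable (raw)]:
  assumes [measurable]: "f \<in> borel_measurable M"
  shows "(\<lambda>w. rpow (f w) a) \<in> borel_measurable M"
  unfolding rpow_def by measurable

text \<open>For \<open>p = 0\<close> this is the unit mass at 0, so that the layer cake formula for \<open>m^p\<close> includes the exponent 0.\<close>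
definition power_measure :: "real \<Rightarrow> real measure" where
  "power_measure p = interval_measure (\<lambda>r. if r < 0 then 0 else rpow r p)"

text \<open>The left endpoint -1 lies below the support, so that the half-open interval contains 0
  and with it the atom present for \<open>p = 0\<close>.\<close>

lemma power_measure:
  assumes "p \<ge> 0"
  shows sigma_finite_power_measure: "sigma_finite_measure (power_measure p)"
    and emeasure_power_measure: "m \<ge> 0 \<Longrightarrow> emeasure (power_measure p) {-1<..m} = ennreal (rpow m p)"
proof -
  let ?F = "\<lambda>r. if r < 0 then 0 else rpow r p"
  have mono: "?F x \<le> ?F y" if "x \<le> y" for x y
    using that assms by (auto intro: rpow_mono)
  have cont: "continuous (at_right a) ?F" for a
  proof (cases "p = 0")
    case False
    have "?F = (\<lambda>r. (max 0 r) powr p)" using False by (auto simp: rpow_def)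
    moreover have "continuous_on UNIV (\<lambda>r::real. (max 0 r) powr p)"
      using False assms by (intro continuous_on_powr' continuous_intros) auto
    ultimately show ?thesis
      by (metis UNIV_I continuous_on_eq_continuous_at continuous_at_imp_continuous_at_within open_UNIV)
  next
    case True
    \<comment> \<open>For \<open>p = 0\<close> the function is a unit step that already has the
      value 1 at 0, hence is continuous from the right.\<close>
    have "eventually (\<lambda>r. ?F r = ?F a) (at_right a)"
    proof (cases "a < 0")
      case True
      then have "eventually (\<lambda>r. r \<in> {a<..<0}) (at_right a)"
        by (intro eventually_at_right_real) auto
      then show ?thesis by eventually_elim (use True in auto)
    next
      case False
      then show ?thesis using \<open>p = 0\<close> eventually_at_right_less[of a]
        by (auto elim!: eventually_mono simp: rpow_def)
    qed
    then show ?thesis unfolding continuous_within by (rule tendsto_eventually)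
  qed
  show "sigma_finite_measure (power_measure p)"
    unfolding power_measure_def by (rule sigma_finite_interval_measure[OF mono cont])
  show "emeasure (power_measure p) {-1<..m} = ennreal (rpow m p)" if "m \<ge> 0"
    unfolding power_measure_def using that
    by (subst emeasure_interval_measure_Ioc[OF _ mono cont]) auto
qed

lemma sets_power_measure [measurable_cong, simp]: "sets (power_measure p) = sets borel"
  by (simp add: power_measure_def)

text \<open>The feature space is the product of the rotation group with the half-line of radii:
  integrating over rotations yields the Legendre factor, integrating over radii yields the power of
  the minimum. The weight \<phi> enters as a product and does not disturb positivity.\<close>

lemma legendre_kernel_integral_nonneg:
  fixes \<phi> :: "real^3 \<Rightarrow> real"
  assumes H: "haar_SO3 H" and "prob_space M" and M [measurable_cong]: "sets M = sets borel"
    and [measurable]: "\<phi> \<in> borel_measurable borel" and p: "p \<ge> 0"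
    and fin: "(\<integral>\<^sup>+ z. ennreal (\<bar>\<phi> (fst z) * \<phi> (snd z)\<bar> * (rpow (min (norm (fst z)) (norm (snd z))) p * (norm (fst z) * norm (snd z))^l)) \<partial>(M \<Otimes>\<^sub>M M)) < \<infinity>"
  shows "0 \<le> (\<integral>z. \<phi> (fst z) * \<phi> (snd z) * (rpow (min (norm (fst z)) (norm (snd z))) p
      * legendre_form l (fst z \<bullet> snd z) ((fst z \<bullet> fst z) * (snd z \<bullet> snd z))) \<partial>(M \<Otimes>\<^sub>M M))"
proof -
  note haar_sets[OF H, measurable_cong]
  interpret M: prob_space M by fact
  interpret H: prob_space H using H by (rule haar_prob_space)
  define \<nu> where "\<nu> = power_measure p"
  interpret N: sigma_finite_measure \<nu> unfolding \<nu>_def using p by (rule sigma_finite_power_measure)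
  interpret HN: pair_sigma_finite H \<nu> ..
  have [measurable_cong]: "sets \<nu> = sets borel" by (simp add: \<nu>_def)
  define \<psi> where "\<psi> = (\<lambda>(U, r) x. of_real (\<phi> x * indicator {-1<..norm x} r) * rotated_null U x ^ l)"
  have ind: "indicator {-1<..norm x} r = (if -1 < r \<and> r \<le> norm x then 1 else 0 :: real)" for x :: "real^3" and r
    by auto
  have [measurable]: "case_prod \<psi> \<in> borel_measurable ((H \<Otimes>\<^sub>M \<nu>) \<Otimes>\<^sub>M M)"
  proof -
    have s: "sets ((H \<Otimes>\<^sub>M \<nu>) \<Otimes>\<^sub>M M) = sets ((borel \<Otimes>\<^sub>M borel) \<Otimes>\<^sub>M borel)"
      using haar_sets[OF H] M by (intro sets_pair_measure_cong) (auto simp: \<nu>_def)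
    have "case_prod \<psi> \<in> borel_measurable ((borel \<Otimes>\<^sub>M borel) \<Otimes>\<^sub>M borel)"
    proof -
      have [measurable]: "(\<lambda>w::((real^3^3) \<times> real) \<times> (real^3). fst (fst w)) \<in> borel_measurable ((borel \<Otimes>\<^sub>M borel) \<Otimes>\<^sub>M borel)"
        "(\<lambda>w::((real^3^3) \<times> real) \<times> (real^3). snd (fst w)) \<in> borel_measurable ((borel \<Otimes>\<^sub>M borel) \<Otimes>\<^sub>M borel)"
        by measurable
      show ?thesis unfolding \<psi>_def split_beta' ind by measurable
    qed
    then show ?thesis by (simp cong: measurable_cong_sets add: s)
  qed
  have [measurable]: "(\<lambda>q. \<psi> q z) \<in> borel_measurable (H \<Otimes>\<^sub>M \<nu>)" for z
    using measurable_Pair1[of "case_prod \<psi>" "H \<Otimes>\<^sub>M \<nu>" M borel z] sets_eq_imp_space_eq[OF M] by simp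
  let ?mn = "\<lambda>x y :: real^3. min (norm x) (norm y)"
  have ind2: "indicator {-1<..norm x} r * indicator {-1<..norm y} r = (indicator {-1<..?mn x y} r :: real)" for x y :: "real^3" and r
    by (auto split: split_indicator)
  \<comment> \<open>One factor \<open>2 ^ l\<close> for each pairing, from the bound
    \<open>cmod (rotated_null U x) \<le> 2 * norm x\<close>.\<close>
  let ?C = "2 ^ l * 2 ^ l"
  have bound: "(\<integral>\<^sup>+ q. ennreal (cmod (\<psi> q x) * cmod (\<psi> q y)) \<partial>(H \<Otimes>\<^sub>M \<nu>))
     \<le> ennreal ?C * ennreal (\<bar>\<phi> x * \<phi> y\<bar> * (rpow (?mn x y) p * (norm x * norm y) ^ l))" for x y
  proof -
    have "(\<integral>\<^sup>+ q. ennreal (cmod (\<psi> q x) * cmod (\<psi> q y)) \<partial>(H \<Otimes>\<^sub>M \<nu>)) = (\<integral>\<^sup>+ U. (\<integral>\<^sup>+ r. ennreal (cmod (\<psi> (U, r) x) * cmod (\<psi> (U, r) y)) \<partial>\<nu>) \<partial>H)"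
      by (subst N.nn_integral_fst[symmetric]) auto
    also have "\<dots> \<le> (\<integral>\<^sup>+ U. ennreal (?C * \<bar>\<phi> x * \<phi> y\<bar> * (norm x * norm y) ^ l) * ennreal (rpow (?mn x y) p) \<partial>H)"
    proof (rule nn_integral_mono_AE)
      show "AE U in H. (\<integral>\<^sup>+ r. ennreal (cmod (\<psi> (U, r) x) * cmod (\<psi> (U, r) y)) \<partial>\<nu>)
         \<le> ennreal (?C * \<bar>\<phi> x * \<phi> y\<bar> * (norm x * norm y) ^ l) * ennreal (rpow (?mn x y) p)"
        using haar_AE_SO3[OF H]
      proof eventually_elim
        case (elim U)
        have "(\<integral>\<^sup>+ r. ennreal (cmod (\<psi> (U, r) x) * cmod (\<psi> (U, r) y)) \<partial>\<nu>)
          \<le> (\<integral>\<^sup>+ r. ennreal (?C * \<bar>\<phi> x * \<phi> y\<bar> * (norm x * norm y) ^ l) * indicator {-1<..?mn x y} r \<partial>\<nu>)"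
        proof (rule nn_integral_mono)
          fix r
          have "cmod (rotated_null U x ^ l * cnj (rotated_null U y ^ l)) \<le> ?C * (norm x * norm y) ^ l"
            using cmod_rotated_null_prod_le[OF elim, of x l y] by (simp add: power_mult_distrib mult_ac)
          then have "\<bar>\<phi> x * \<phi> y\<bar> * cmod (rotated_null U x ^ l * cnj (rotated_null U y ^ l)) \<le> \<bar>\<phi> x * \<phi> y\<bar> * (?C * (norm x * norm y) ^ l)"
            by (intro mult_left_mono) auto
          then show "ennreal (cmod (\<psi> (U, r) x) * cmod (\<psi> (U, r) y)) \<le> ennreal (?C * \<bar>\<phi> x * \<phi> y\<bar> * (norm x * norm y) ^ l) * indicator {-1<..?mn x y} r"
            by (auto simp: \<psi>_def norm_mult norm_power abs_mult mult_ac split: split_indicator intro!: ennreal_leI)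
        qed
        also have "\<dots> = ennreal (?C * \<bar>\<phi> x * \<phi> y\<bar> * (norm x * norm y) ^ l) * ennreal (rpow (?mn x y) p)"
          by (subst nn_integral_cmult) (auto simp: \<nu>_def emeasure_power_measure[OF p])
        finally show ?case .
      qed
    qed
    also have "\<dots> = ennreal ?C * ennreal (\<bar>\<phi> x * \<phi> y\<bar> * (rpow (?mn x y) p * (norm x * norm y) ^ l))"
      by (simp add: H.emeasure_space_1 ennreal_mult[symmetric] mult_ac)
    finally show ?thesis .
  qed
  have val: "(\<integral>q. \<psi> q x * cnj (\<psi> q y) \<partial>(H \<Otimes>\<^sub>M \<nu>)) = of_real (haar_const H l *
      (\<phi> x * \<phi> y * (rpow (?mn x y) p * legendre_form l (x \<bullet> y) ((x \<bullet> x) * (y \<bullet> y)))))" for x y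
  proof -
    have "integrable (H \<Otimes>\<^sub>M \<nu>) (\<lambda>q. \<psi> q x * cnj (\<psi> q y))"
      unfolding integrable_iff_bounded
    proof
      have "(\<integral>\<^sup>+ q. ennreal (norm (\<psi> q x * cnj (\<psi> q y))) \<partial>(H \<Otimes>\<^sub>M \<nu>)) \<le> ennreal ?C * ennreal (\<bar>\<phi> x * \<phi> y\<bar> * (rpow (?mn x y) p * (norm x * norm y) ^ l))"
        using bound[of x y] by (simp add: norm_mult)
      also have "\<dots> < \<infinity>" by (simp add: ennreal_mult_less_top)
      finally show "(\<integral>\<^sup>+ q. ennreal (norm (\<psi> q x * cnj (\<psi> q y))) \<partial>(H \<Otimes>\<^sub>M \<nu>)) < \<infinity>" .
    qed measurable
    then have "(\<integral>q. \<psi> q x * cnj (\<psi> q y) \<partial>(H \<Otimes>\<^sub>M \<nu>)) = (\<integral>U. (\<integral>r. \<psi> (U, r) x * cnj (\<psi> (U, r) y) \<partial>\<nu>) \<partial>H)"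
      by (rule HN.integral_fst'[symmetric])
    also have "\<dots> = (\<integral>U. (\<integral>r. of_real (indicator {-1<..?mn x y} r) * (of_real (\<phi> x * \<phi> y) * (rotated_null U x ^ l * cnj (rotated_null U y ^ l))) \<partial>\<nu>) \<partial>H)"
      unfolding ind2[symmetric] \<psi>_def by (simp add: mult_ac)
    also have "\<dots> = of_real (measure \<nu> {-1<..?mn x y}) * (of_real (\<phi> x * \<phi> y) * (\<integral>U. rotated_null U x ^ l * cnj (rotated_null U y ^ l) \<partial>H))"
      by (simp only: integral_mult_left_zero integral_mult_right_zero integral_complex_of_real) (simp add: \<nu>_def power_measure_def)
    also have "measure \<nu> {-1<..?mn x y} = rpow (?mn x y) p"
      by (simp add: measure_def \<nu>_def emeasure_power_measure[OF p])
    finally show ?thesis by (simp only: haar_addition_theorem[OF H] of_real_mult mult_ac)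
  qed
  have "0 \<le> Re (\<integral>z. (\<integral>q. \<psi> q (fst z) * cnj (\<psi> q (snd z)) \<partial>(H \<Otimes>\<^sub>M \<nu>)) \<partial>(M \<Otimes>\<^sub>M M))"
  proof (rule integral_feature_product_nonneg[OF M.sigma_finite_measure_axioms HN.P.sigma_finite_measure_axioms])
    have "(\<integral>\<^sup>+ z. (\<integral>\<^sup>+ q. ennreal (cmod (\<psi> q (fst z)) * cmod (\<psi> q (snd z))) \<partial>(H \<Otimes>\<^sub>M \<nu>)) \<partial>(M \<Otimes>\<^sub>M M))
      \<le> (\<integral>\<^sup>+ z. ennreal ?C * ennreal (\<bar>\<phi> (fst z) * \<phi> (snd z)\<bar> * (rpow (?mn (fst z) (snd z)) p * (norm (fst z) * norm (snd z))^l)) \<partial>(M \<Otimes>\<^sub>M M))"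
      by (rule nn_integral_mono) (rule bound)
    also have "\<dots> = ennreal ?C * (\<integral>\<^sup>+ z. ennreal (\<bar>\<phi> (fst z) * \<phi> (snd z)\<bar> * (rpow (?mn (fst z) (snd z)) p * (norm (fst z) * norm (snd z))^l)) \<partial>(M \<Otimes>\<^sub>M M))"
      by (rule nn_integral_cmult) measurable
    also have "\<dots> < \<infinity>" using fin by (simp add: ennreal_mult_less_top)
    finally show "(\<integral>\<^sup>+ z. (\<integral>\<^sup>+ q. ennreal (cmod (\<psi> q (fst z)) * cmod (\<psi> q (snd z))) \<partial>(H \<Otimes>\<^sub>M \<nu>)) \<partial>(M \<Otimes>\<^sub>M M)) < \<infinity>" .
  qed measurable
  also have "\<dots> = haar_const H l * (\<integral>z. \<phi> (fst z) * \<phi> (snd z) * (rpow (?mn (fst z) (snd z)) p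
      * legendre_form l (fst z \<bullet> snd z) ((fst z \<bullet> fst z) * (snd z \<bullet> snd z))) \<partial>(M \<Otimes>\<^sub>M M))"
    unfolding val by (simp only: integral_complex_of_real Re_complex_of_real integral_mult_right_zero)
  finally show ?thesis using haar_const_pos[OF H, of l] by (simp add: zero_le_mult_iff)
qed

section \<open>The multipole terms: majorants and positivity\<close>

text \<open>With \<open>m\<close> the larger and \<open>m'\<close> the smaller norm,
  \<open>legendre_form\<close> contains \<open>(m * m')^l\<close>; division by
  \<open>m^(2*l)\<close> leaves \<open>(m' / m)^l * P_l\<close>. At \<open>x = y = 0\<close>
  division by zero gives the value 0.\<close>

definition legendre_term :: "real \<Rightarrow> nat \<Rightarrow> real^3 \<Rightarrow> real^3 \<Rightarrow> real" where
  "legendre_term s l x y = (rpow (norm x) s + rpow (norm y) s) / (2 * max (norm x) (norm y))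
     * (legendre_form l (x \<bullet> y) ((x \<bullet> x) * (y \<bullet> y)) / max (norm x) (norm y) ^ (2*l))"

lemma borel_measurable_legendre_term [measurable (raw)]:
  assumes [measurable]: "f \<in> borel_measurable M" "g \<in> borel_measurable M"
  shows "(\<lambda>w. legendre_term s l (f w) (g w)) \<in> borel_measurable M"
  unfolding legendre_term_def by measurable

lemma legendre_form_0_0: "l \<ge> 1 \<Longrightarrow> legendre_form l 0 0 = 0"
  by (simp add: legendre_form_def)

lemma abs_legendre_form_divide_max_le:
  fixes x y :: "real^3"
  shows "\<bar>legendre_form l (x \<bullet> y) ((x \<bullet> x) * (y \<bullet> y))\<bar> / max (norm x) (norm y) ^ (2*l) \<le> 1"
proof -
  let ?M = "max (norm x) (norm y)"
  have "(norm x * norm y) ^ l \<le> (?M * ?M) ^ l" by (intro power_mono mult_mono) (auto simp: le_max_iff_disj)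
  also have "\<dots> = ?M ^ (2 * l)" by (simp add: power_mult power2_eq_square)
  finally have "\<bar>legendre_form l (x \<bullet> y) ((x \<bullet> x) * (y \<bullet> y))\<bar> \<le> ?M ^ (2*l)"
    using abs_legendre_form_inner_le[of l x y] by simp
  moreover have "0 \<le> ?M ^ (2*l)" by (simp add: le_max_iff_disj)
  ultimately show ?thesis unfolding divide_le_eq_1 by (metis less_le)
qed

text \<open>Strict at \<open>r = 0\<close>, \<open>s = 1\<close>, where the left-hand side is \<open>0 / 0 = 0\<close> and the right-hand side is 1.\<close>
lemma rpow_divide_le:
  assumes "r \<ge> 0" "s \<ge> 1"
  shows "rpow r s / r \<le> rpow r (s - 1)"
  using assms by (cases "r = 0") (auto simp: rpow_def powr_diff)

text \<open>A majorant independent of \<open>l\<close> and integrable by the moment condition alone,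
  so each term is integrable even when \<open>I_s\<close> is infinite.\<close>

lemma legendre_term_bound:
  assumes "s \<ge> 1"
  shows "\<bar>legendre_term s l x y\<bar> \<le> rpow (norm x) (s - 1) + rpow (norm y) (s - 1)"
proof -
  let ?M = "max (norm x) (norm y)"
  have M: "?M \<ge> 0" by (simp add: le_max_iff_disj)
  have 1: "rpow (norm x) s \<le> rpow ?M s" "rpow (norm y) s \<le> rpow ?M s"
    using assms by (auto intro!: rpow_mono)
  have "\<bar>legendre_term s l x y\<bar> = (rpow (norm x) s + rpow (norm y) s) / (2 * ?M) * (\<bar>legendre_form l (x \<bullet> y) ((x \<bullet> x) * (y \<bullet> y))\<bar> / ?M ^ (2*l))"
    using M by (simp add: legendre_term_def abs_mult power_abs abs_of_nonneg[OF M])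
  also have "\<dots> \<le> (rpow ?M s + rpow ?M s) / (2 * ?M) * 1"
    using 1 by (intro mult_mono divide_right_mono abs_legendre_form_divide_max_le add_mono) (auto simp: le_max_iff_disj intro!: divide_nonneg_nonneg add_nonneg_nonneg)
  also have "\<dots> = rpow ?M s / ?M" by simp
  also have "\<dots> \<le> rpow ?M (s - 1)" using assms by (intro rpow_divide_le) (auto simp: le_max_iff_disj)
  also have "\<dots> \<le> rpow (norm x) (s - 1) + rpow (norm y) (s - 1)"
    by (auto simp: max_def)
  finally show ?thesis .
qed

text \<open>Since \<open>max = |x| |y| / min\<close>, each power of the maximum becomes a product
  weight times a power of the minimum. The weights are those of \<open>P_l\<close> lowered by
  \<open>l\<close>, because \<open>legendre_form\<close> already carries
  \<open>(|x| |y|)^l\<close>.\<close>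

lemma legendre_term_split:
  assumes "x \<noteq> 0" "y \<noteq> 0"
  shows "legendre_term s l x y = 1/2 * (
      norm x powr (s - 1 - 2 * real l) * norm y powr (s - 1 - 2 * real l) * (rpow (min (norm x) (norm y)) (2 * real l + 1 - s) * legendre_form l (x \<bullet> y) ((x \<bullet> x) * (y \<bullet> y)))
    + norm x powr (- (2 * real l + 1)) * norm y powr (- (2 * real l + 1)) * (rpow (min (norm x) (norm y)) (s + 2 * real l + 1) * legendre_form l (x \<bullet> y) ((x \<bullet> x) * (y \<bullet> y))))"
proof -
  have *: "(rpow a s + rpow b s) / (2 * max a b) / max a b ^ (2*l) = 1/2 * (
     a powr (s - 1 - 2 * real l) * b powr (s - 1 - 2 * real l) * rpow (min a b) (2 * real l + 1 - s) +
     a powr (- (2 * real l + 1)) * b powr (- (2 * real l + 1)) * rpow (min a b) (s + 2 * real l + 1))"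
    if "0 < a" "a \<le> b" for a b :: real
  proof -
    have b: "b > 0" using that by simp
    have e1: "(a powr s + b powr s) / (2 * b) / b ^ (2*l) = 1/2 * (b powr (s - 1 - 2 * real l) + a powr s * b powr (- (2 * real l + 1)))"
      using b by (simp add: powr_diff powr_minus powr_add powr_realpow[symmetric] field_simps)
    have e2: "a powr (s - 1 - 2 * real l) * b powr (s - 1 - 2 * real l) * a powr (2 * real l + 1 - s) = b powr (s - 1 - 2 * real l)"
      using that by (simp add: mult_ac powr_add[symmetric])
    have e3: "a powr (- (2 * real l + 1)) * b powr (- (2 * real l + 1)) * a powr (s + 2 * real l + 1) = a powr s * b powr (- (2 * real l + 1))"
      using that by (simp add: mult_ac powr_add[symmetric])
    show ?thesis
      unfolding max_absorb2[OF that(2)] min_absorb1[OF that(2)] rpow_eq_powr[OF that(1)] rpow_eq_powr[OF b] e1 e2 e3 ..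
  qed
  let ?a = "norm x" and ?b = "norm y"
  have "(rpow ?a s + rpow ?b s) / (2 * max ?a ?b) / max ?a ?b ^ (2*l) = 1/2 * (
     ?a powr (s - 1 - 2 * real l) * ?b powr (s - 1 - 2 * real l) * rpow (min ?a ?b) (2 * real l + 1 - s) +
     ?a powr (- (2 * real l + 1)) * ?b powr (- (2 * real l + 1)) * rpow (min ?a ?b) (s + 2 * real l + 1))"
  proof (cases "?a \<le> ?b")
    case True
    then show ?thesis using assms by (intro *) auto
  next
    case False
    then show ?thesis using *[of ?b ?a] assms by (simp add: max.commute min.commute mult.commute add.commute)
  qed
  moreover have "legendre_term s l x y = (rpow ?a s + rpow ?b s) / (2 * max ?a ?b) / max ?a ?b ^ (2*l) * legendre_form l (x \<bullet> y) ((x \<bullet> x) * (y \<bullet> y))"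
    by (simp add: legendre_term_def)
  ultimately have "legendre_term s l x y = 1/2 * (
     ?a powr (s - 1 - 2 * real l) * ?b powr (s - 1 - 2 * real l) * rpow (min ?a ?b) (2 * real l + 1 - s) +
     ?a powr (- (2 * real l + 1)) * ?b powr (- (2 * real l + 1)) * rpow (min ?a ?b) (s + 2 * real l + 1)) * legendre_form l (x \<bullet> y) ((x \<bullet> x) * (y \<bullet> y))"
    by (simp only:)
  then show ?thesis by (simp only: algebra_simps)
qed

text \<open>Positivity is proved for the two summands separately, so each needs its own integrable
  majorant. For \<open>a \<le> b\<close> they reduce to \<open>a^l * b^(s-1-l)\<close> and
  \<open>a^(s+l) * b^(-l-1)\<close>, both at most \<open>b^(s-1)\<close>.\<close>

lemma powr_weight_bound:
  assumes s: "s \<ge> 1" and l: "l \<ge> (1::nat)" and a: "0 < a" "0 < b"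
  shows "a powr (s - 1 - 2 * real l) * b powr (s - 1 - 2 * real l) * (rpow (min a b) (2 * real l + 1 - s) * (a * b) ^ l) \<le> rpow a (s - 1) + rpow b (s - 1)"
    and "a powr (- (2 * real l + 1)) * b powr (- (2 * real l + 1)) * (rpow (min a b) (s + 2 * real l + 1) * (a * b) ^ l) \<le> rpow a (s - 1) + rpow b (s - 1)"
proof -
  have *: "a powr (s - 1 - 2 * real l) * b powr (s - 1 - 2 * real l) * (rpow (min a b) (2 * real l + 1 - s) * (a * b) ^ l) \<le> b powr (s - 1)
    \<and> a powr (- (2 * real l + 1)) * b powr (- (2 * real l + 1)) * (rpow (min a b) (s + 2 * real l + 1) * (a * b) ^ l) \<le> b powr (s - 1)"
    if "0 < a" "a \<le> b" for a b :: real
  proof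
    have b: "b > 0" using that by simp
    have ab: "(a * b) ^ l = a powr real l * b powr l" using that b by (simp add: powr_realpow power_mult_distrib)
    have "a powr (s - 1 - 2 * real l) * b powr (s - 1 - 2 * real l) * (rpow (min a b) (2 * real l + 1 - s) * (a * b) ^ l)
      = a powr (s - 1 - 2 * real l) * a powr (2 * real l + 1 - s) * a powr real l * (b powr (s - 1 - 2 * real l) * b powr real l)"
      using that b by (simp add: ab rpow_eq_powr min_absorb1)
    also have "\<dots> = a powr real l * b powr (s - 1 - real l)"
      using that b by (simp add: powr_add[symmetric])
    also have "\<dots> \<le> b powr real l * b powr (s - 1 - real l)"
      using that by (intro mult_right_mono powr_mono2) auto
    also have "\<dots> = b powr (s - 1)" using b by (simp add: powr_add[symmetric])
    finally show "a powr (s - 1 - 2 * real l) * b powr (s - 1 - 2 * real l) * (rpow (min a b) (2 * real l + 1 - s) * (a * b) ^ l) \<le> b powr (s - 1)" .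
    have "a powr (- (2 * real l + 1)) * b powr (- (2 * real l + 1)) * (rpow (min a b) (s + 2 * real l + 1) * (a * b) ^ l)
      = a powr (- (2 * real l + 1)) * a powr (s + 2 * real l + 1) * a powr real l * (b powr (- (2 * real l + 1)) * b powr real l)"
      using that b by (simp add: ab rpow_eq_powr min_absorb1)
    also have "\<dots> = a powr (s + real l) * b powr (- real l - 1)"
      using that b by (simp add: powr_add[symmetric])
    also have "\<dots> \<le> b powr (s + real l) * b powr (- real l - 1)"
      using that s by (intro mult_right_mono powr_mono2) auto
    also have "\<dots> = b powr (s - 1)" using b by (simp add: powr_add[symmetric])
    finally show "a powr (- (2 * real l + 1)) * b powr (- (2 * real l + 1)) * (rpow (min a b) (s + 2 * real l + 1) * (a * b) ^ l) \<le> b powr (s - 1)" .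
  qed
  have le: "b powr (s - 1) \<le> rpow a (s - 1) + rpow b (s - 1)" "a powr (s - 1) \<le> rpow a (s - 1) + rpow b (s - 1)"
    using a by (auto simp: rpow_eq_powr)
  show "a powr (s - 1 - 2 * real l) * b powr (s - 1 - 2 * real l) * (rpow (min a b) (2 * real l + 1 - s) * (a * b) ^ l) \<le> rpow a (s - 1) + rpow b (s - 1)"
    using *[of a b] *[of b a] a le by (cases "a \<le> b") (auto simp: min.commute mult.commute mult.left_commute intro: order_trans)
  show "a powr (- (2 * real l + 1)) * b powr (- (2 * real l + 1)) * (rpow (min a b) (s + 2 * real l + 1) * (a * b) ^ l) \<le> rpow a (s - 1) + rpow b (s - 1)"
    using *[of a b] *[of b a] a le by (cases "a \<le> b") (auto simp: min.commute mult.commute mult.left_commute intro: order_trans)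
qed

lemma moment_pair_finite:
  assumes "prob_space M" and [measurable_cong]: "sets M = sets borel" and fin: "moment s M < \<infinity>"
  shows "(\<integral>\<^sup>+ z. ennreal (rpow (norm (fst z)) (s - 1) + rpow (norm (snd z)) (s - 1)) \<partial>(M \<Otimes>\<^sub>M M)) < \<infinity>"
proof -
  interpret M: prob_space M by fact
  have "(\<integral>\<^sup>+ z. ennreal (rpow (norm (fst z)) (s - 1) + rpow (norm (snd z)) (s - 1)) \<partial>(M \<Otimes>\<^sub>M M))
    = (\<integral>\<^sup>+ x. (\<integral>\<^sup>+ y. ennreal (rpow (norm x) (s - 1)) + ennreal (rpow (norm y) (s - 1)) \<partial>M) \<partial>M)"
    by (subst M.nn_integral_fst[symmetric]) (auto simp: ennreal_plus)
  also have "\<dots> = (\<integral>\<^sup>+ x. ennreal (rpow (norm x) (s - 1)) + moment s M \<partial>M)"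
    by (subst nn_integral_add) (auto simp: moment_def M.emeasure_space_1)
  also have "\<dots> = moment s M + moment s M"
    by (subst nn_integral_add) (auto simp: moment_def M.emeasure_space_1)
  finally show ?thesis using fin by simp
qed

lemma legendre_term_integrable:
  assumes "prob_space M" and [measurable_cong]: "sets M = sets borel" and fin: "moment s M < \<infinity>" and s: "s \<ge> 1"
  shows "integrable (M \<Otimes>\<^sub>M M) (\<lambda>z. legendre_term s l (fst z) (snd z))"
proof (rule integrableI_bounded)
  have "(\<integral>\<^sup>+ z. ennreal (norm (legendre_term s l (fst z) (snd z))) \<partial>(M \<Otimes>\<^sub>M M))
    \<le> (\<integral>\<^sup>+ z. ennreal (rpow (norm (fst z)) (s - 1) + rpow (norm (snd z)) (s - 1)) \<partial>(M \<Otimes>\<^sub>M M))"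
    using legendre_term_bound[OF s] by (intro nn_integral_mono ennreal_leI) simp
  then show "(\<integral>\<^sup>+ z. ennreal (norm (legendre_term s l (fst z) (snd z))) \<partial>(M \<Otimes>\<^sub>M M)) < \<infinity>"
    using moment_pair_finite[OF assms(1-3)] by (rule le_less_trans)
qed measurable

lemma legendre_term_integral_nonneg:
  assumes H: "haar_SO3 H" and M: "prob_space M" and sets [measurable_cong]: "sets M = sets borel" and fin: "moment s M < \<infinity>"
    and s: "1 \<le> s" "s \<le> 3" and l: "l \<ge> 1"
  shows "0 \<le> (\<integral>z. legendre_term s l (fst z) (snd z) \<partial>(M \<Otimes>\<^sub>M M))"
proof -
  define K where "K = (\<lambda>e p (z::(real^3) \<times> (real^3)). norm (fst z) powr e * norm (snd z) powr e * (rpow (min (norm (fst z)) (norm (snd z))) p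
      * legendre_form l (fst z \<bullet> snd z) ((fst z \<bullet> fst z) * (snd z \<bullet> snd z))) :: real)"
  have split: "legendre_term s l (fst z) (snd z) = 1/2 * (K (s - 1 - 2 * real l) (2 * real l + 1 - s) z + K (- (2 * real l + 1)) (s + 2 * real l + 1) z)"
    for z :: "(real^3) \<times> (real^3)"
  \<comment> \<open>If a vector vanishes, both sides are 0: on the left because
    \<open>legendre_form l 0 0 = 0\<close> for \<open>l \<ge> 1\<close>, on the right because
    \<open>0 powr e = 0\<close>.\<close>
  proof (cases "fst z = 0 \<or> snd z = 0")
    case True
    then show ?thesis using legendre_form_0_0[OF l] by (auto simp: legendre_term_def K_def)
  next
    case False
    then show ?thesis unfolding K_def by (intro legendre_term_split) auto
  qed
  have *: "integrable (M \<Otimes>\<^sub>M M) (K e p) \<and> 0 \<le> (\<integral>z. K e p z \<partial>(M \<Otimes>\<^sub>M M))"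
    if p: "p \<ge> 0" and b: "\<And>a b. 0 < a \<Longrightarrow> 0 < b \<Longrightarrow> a powr e * b powr e * (rpow (min a b) p * (a * b) ^ l) \<le> rpow a (s - 1) + rpow b (s - 1)" for e p
  proof -
    have bd: "\<bar>norm (fst z) powr e * norm (snd z) powr e\<bar> * (rpow (min (norm (fst z)) (norm (snd z))) p * (norm (fst z) * norm (snd z)) ^ l)
        \<le> rpow (norm (fst z)) (s - 1) + rpow (norm (snd z)) (s - 1)" for z :: "(real^3) \<times> (real^3)"
      using b[of "norm (fst z)" "norm (snd z)"] by (cases "fst z = 0 \<or> snd z = 0") (auto simp: abs_mult)
    have fin': "(\<integral>\<^sup>+ z. ennreal (\<bar>norm (fst z) powr e * norm (snd z) powr e\<bar> * (rpow (min (norm (fst z)) (norm (snd z))) p * (norm (fst z) * norm (snd z)) ^ l)) \<partial>(M \<Otimes>\<^sub>M M)) < \<infinity>"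
      by (rule le_less_trans[OF nn_integral_mono moment_pair_finite[OF M sets fin]]) (intro ennreal_leI bd)
    have "integrable (M \<Otimes>\<^sub>M M) (K e p)"
    proof (rule integrableI_bounded)
      show "K e p \<in> borel_measurable (M \<Otimes>\<^sub>M M)" unfolding K_def by measurable
      have "norm (K e p z) \<le> \<bar>norm (fst z) powr e * norm (snd z) powr e\<bar> * (rpow (min (norm (fst z)) (norm (snd z))) p * (norm (fst z) * norm (snd z)) ^ l)" for z
        unfolding K_def real_norm_def abs_mult[of _ "_ * legendre_form _ _ _"] abs_mult[of "rpow _ _"]
        by (intro mult_left_mono mult_mono abs_legendre_form_inner_le) auto
      then show "(\<integral>\<^sup>+ z. ennreal (norm (K e p z)) \<partial>(M \<Otimes>\<^sub>M M)) < \<infinity>"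
        by (intro le_less_trans[OF nn_integral_mono fin'] ennreal_leI)
    qed
    moreover have "0 \<le> (\<integral>z. K e p z \<partial>(M \<Otimes>\<^sub>M M))" unfolding K_def
      by (rule legendre_kernel_integral_nonneg[OF H M sets _ p fin']) measurable
    ultimately show ?thesis by simp
  qed
  have 1: "integrable (M \<Otimes>\<^sub>M M) (K (s - 1 - 2 * real l) (2 * real l + 1 - s)) \<and> 0 \<le> (\<integral>z. K (s - 1 - 2 * real l) (2 * real l + 1 - s) z \<partial>(M \<Otimes>\<^sub>M M))"
    using s l by (intro * powr_weight_bound(1)) auto
  have 2: "integrable (M \<Otimes>\<^sub>M M) (K (- (2 * real l + 1)) (s + 2 * real l + 1)) \<and> 0 \<le> (\<integral>z. K (- (2 * real l + 1)) (s + 2 * real l + 1) z \<partial>(M \<Otimes>\<^sub>M M))"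
    using s l by (intro * powr_weight_bound(2)) auto
  show ?thesis unfolding split using 1 2 by (simp add: Bochner_Integration.integral_add)
qed

section \<open>Comparison with the radial part\<close>

text \<open>\<open>|x - \<kappa> y|\<close> if \<open>x\<close> is the longer vector, \<open>|y - \<kappa> x|\<close> otherwise; 0 at \<open>x = y = 0\<close>.\<close>
definition damped_dist :: "real \<Rightarrow> real^3 \<Rightarrow> real^3 \<Rightarrow> real" where
  "damped_dist \<kappa> x y = (let m = max (norm x) (norm y) in
     m * sqrt (1 - 2 * (\<kappa> / m\<^sup>2) * (x \<bullet> y) + (\<kappa> / m\<^sup>2)\<^sup>2 * ((x \<bullet> x) * (y \<bullet> y))))"

definition damped_kernel :: "real \<Rightarrow> real \<Rightarrow> real^3 \<Rightarrow> real^3 \<Rightarrow> real" where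
  "damped_kernel s \<kappa> x y = (rpow (norm x) s + rpow (norm y) s) / (2 * damped_dist \<kappa> x y)"

text \<open>Extended values matter on the diagonal: the kernel is infinite at \<open>x = y\<close>
  away from the origin and, for nonzero \<open>s\<close>, equals 0 at the origin.\<close>

definition coulomb_kernel :: "real \<Rightarrow> real^3 \<Rightarrow> real^3 \<Rightarrow> ennreal" where
  "coulomb_kernel s x y = ennreal (rpow (norm x) s + rpow (norm y) s) / (2 * ennreal (norm (x - y)))"

lemma borel_measurable_damped_kernel [measurable (raw)]:
  assumes [measurable]: "f \<in> borel_measurable M" "g \<in> borel_measurable M"
  shows "(\<lambda>w. damped_kernel s \<kappa> (f w) (g w)) \<in> borel_measurable M"
  unfolding damped_kernel_def damped_dist_def Let_def by measurable

lemma borel_measurable_coulomb_kernel [measurable (raw)]: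
  assumes [measurable]: "f \<in> borel_measurable M" "g \<in> borel_measurable M"
  shows "(\<lambda>w. coulomb_kernel s (f w) (g w)) \<in> borel_measurable M"
  unfolding coulomb_kernel_def by measurable

lemma damped_dist_commute: "damped_dist \<kappa> x y = damped_dist \<kappa> y x"
  by (simp add: damped_dist_def max.commute inner_commute mult.commute)

lemma damped_dist_eq:
  assumes "norm y \<le> norm x"
  shows "damped_dist \<kappa> x y = norm (x - \<kappa> *\<^sub>R y)"
proof (cases "x = 0")
  case True
  then show ?thesis using assms by (simp add: damped_dist_def)
next
  case False
  then have n: "norm x > 0" by simp
  have "(norm x)\<^sup>2 * (1 - 2 * (\<kappa> / (norm x)\<^sup>2) * (x \<bullet> y) + (\<kappa> / (norm x)\<^sup>2)\<^sup>2 * ((x \<bullet> x) * (y \<bullet> y)))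
     = (norm x)\<^sup>2 - 2 * \<kappa> * (x \<bullet> y) + \<kappa>\<^sup>2 * (y \<bullet> y)"
    using n unfolding power2_norm_eq_inner[symmetric] by (simp add: field_simps power2_eq_square)
  also have "\<dots> = (norm (x - \<kappa> *\<^sub>R y))\<^sup>2"
    unfolding power2_norm_eq_inner
    by (simp add: inner_diff_left inner_diff_right inner_commute power2_eq_square algebra_simps)
  finally have "sqrt ((norm x)\<^sup>2 * (1 - 2 * (\<kappa> / (norm x)\<^sup>2) * (x \<bullet> y) + (\<kappa> / (norm x)\<^sup>2)\<^sup>2 * ((x \<bullet> x) * (y \<bullet> y)))) = norm (x - \<kappa> *\<^sub>R y)"
    by simp
  then show ?thesis using assms by (simp add: damped_dist_def max_absorb1 real_sqrt_mult Let_def)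
qed

lemma damped_dist_nonneg: "0 \<le> damped_dist \<kappa> x y"
  using damped_dist_eq[of y x \<kappa>] damped_dist_eq[of x y \<kappa>] damped_dist_commute[of \<kappa> x y]
  by (cases "norm y \<le> norm x") auto

lemma damped_kernel_nonneg [simp]: "0 \<le> damped_kernel s \<kappa> x y"
  by (simp add: damped_kernel_def damped_dist_nonneg)

text \<open>For \<open>|y| \<le> |x|\<close> the displacement \<open>(1 - \<kappa>) |y|\<close> is
  at most \<open>|x| - \<kappa> |y|\<close>, hence at most \<open>|x - \<kappa> y|\<close>. This is
  why the shorter vector is damped; shrinking the longer one could make it meet the other and create
  a new singularity.\<close>

lemma dist_le_damped_dist:
  assumes "0 \<le> \<kappa>" "\<kappa> \<le> 1"
  shows "norm (x - y) \<le> 2 * damped_dist \<kappa> x y"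
proof -
  have *: "norm (x - y) \<le> 2 * norm (x - \<kappa> *\<^sub>R y)" if "norm y \<le> norm x" for x y :: "real^3"
  proof -
    have "norm (x - y) \<le> norm (x - \<kappa> *\<^sub>R y) + norm ((1 - \<kappa>) *\<^sub>R y)"
      using norm_triangle_ineq4[of "x - \<kappa> *\<^sub>R y" "(1 - \<kappa>) *\<^sub>R y"] by (simp add: algebra_simps)
    moreover have "norm ((1 - \<kappa>) *\<^sub>R y) \<le> norm x - norm (\<kappa> *\<^sub>R y)"
    proof -
      have "norm ((1 - \<kappa>) *\<^sub>R y) + norm (\<kappa> *\<^sub>R y) = (1 - \<kappa>) * norm y + \<kappa> * norm y"
        using assms unfolding norm_scaleR by simp
      also have "\<dots> = norm y" by (simp add: algebra_simps)
      finally show ?thesis using that by linarith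
    qed
    moreover have "norm x - norm (\<kappa> *\<^sub>R y) \<le> norm (x - \<kappa> *\<^sub>R y)" by (rule norm_triangle_ineq2)
    ultimately show ?thesis by simp
  qed
  show ?thesis
    using *[of y x] *[of x y] damped_dist_eq[of y x \<kappa>] damped_dist_eq[of x y \<kappa>] damped_dist_commute[of \<kappa> x y]
    by (cases "norm y \<le> norm x") (auto simp: norm_minus_commute)
qed

lemma damped_dist_tendsto:
  "((\<lambda>n. damped_dist (\<kappa> n) x y) \<longlongrightarrow> norm (x - y)) F" if "(\<kappa> \<longlongrightarrow> 1) F"
proof -
  have *: "((\<lambda>n. norm (x - \<kappa> n *\<^sub>R y)) \<longlongrightarrow> norm (x - y)) F" for x y :: "real^3"
    using that by (auto intro!: tendsto_eq_intros)
  show ?thesis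
    using *[of x y] *[of y x] damped_dist_eq[of y x] damped_dist_eq[of x y] damped_dist_commute[of _ x y]
    by (cases "norm y \<le> norm x") (auto simp: norm_minus_commute)
qed

lemma damped_kernel_sums:
  assumes "0 \<le> \<kappa>" "\<kappa> < 1"
  shows "(\<lambda>l. \<kappa> ^ l * legendre_term s l x y) sums damped_kernel s \<kappa> x y"
proof -
  define m where "m = max (norm x) (norm y)"
  \<comment> \<open>With this ratio \<open>r * |x| |y| = \<kappa> * m' / m\<close>, where
    \<open>m'\<close> is the smaller norm; this is at most \<kappa>, as the generating function
    requires.\<close>
  define r where "r = \<kappa> / m\<^sup>2"
  define S where "S = rpow (norm x) s + rpow (norm y) s"
  have m: "norm x \<le> m" "norm y \<le> m" "0 \<le> m" by (auto simp: m_def le_max_iff_disj)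
  have "r * sqrt ((x \<bullet> x) * (y \<bullet> y)) = r * (norm x * norm y)" by (simp add: real_sqrt_mult norm_eq_sqrt_inner)
  also have "\<dots> \<le> r * (m * m)" using m assms by (intro mult_left_mono mult_mono) (auto simp: r_def)
  also have "\<dots> \<le> \<kappa>" using assms by (simp add: r_def power2_eq_square)
  finally have "r * sqrt ((x \<bullet> x) * (y \<bullet> y)) < 1" using assms by simp
  then have "(\<lambda>l. r ^ l * legendre_form l (x \<bullet> y) ((x \<bullet> x) * (y \<bullet> y))) sums (1 / sqrt (1 - 2 * r * (x \<bullet> y) + r\<^sup>2 * ((x \<bullet> x) * (y \<bullet> y))))"
    using assms by (intro legendre_form_generating_function Cauchy_Schwarz_ineq) (auto simp: r_def)
  then have "(\<lambda>l. S / (2 * m) * (r ^ l * legendre_form l (x \<bullet> y) ((x \<bullet> x) * (y \<bullet> y)))) sums (S / (2 * m) * (1 / sqrt (1 - 2 * r * (x \<bullet> y) + r\<^sup>2 * ((x \<bullet> x) * (y \<bullet> y)))))"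
    by (rule sums_mult)
  moreover have "S / (2 * m) * (r ^ l * legendre_form l (x \<bullet> y) ((x \<bullet> x) * (y \<bullet> y))) = \<kappa> ^ l * legendre_term s l x y" for l
    by (simp add: legendre_term_def S_def[symmetric] m_def[symmetric] r_def power_divide power_mult)
  moreover have "S / (2 * m) * (1 / sqrt (1 - 2 * r * (x \<bullet> y) + r\<^sup>2 * ((x \<bullet> x) * (y \<bullet> y)))) = damped_kernel s \<kappa> x y"
    by (simp add: damped_kernel_def damped_dist_def S_def[symmetric] m_def[symmetric] r_def)
  ultimately show ?thesis by simp
qed

lemma damped_kernel_le_coulomb_kernel:
  assumes "0 \<le> \<kappa>" "\<kappa> \<le> 1"
  shows "ennreal (damped_kernel s \<kappa> x y) \<le> 2 * coulomb_kernel s x y"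
proof -
  let ?S = "rpow (norm x) s + rpow (norm y) s"
  have S: "?S \<ge> 0" by simp
  consider "?S = 0" | "?S > 0" "x = y" | "x \<noteq> y" using S by linarith
  then show ?thesis
  proof cases
    case 1
    then show ?thesis by (simp only: damped_kernel_def) simp
  next
    case 2
    then show ?thesis by (simp add: coulomb_kernel_def ennreal_divide_zero ennreal_mult_top)
  next
    case 3
    then have n: "norm (x - y) > 0" by simp
    have "damped_kernel s \<kappa> x y \<le> ?S / norm (x - y)"
      unfolding damped_kernel_def by (rule frac_le[OF S order_refl n dist_le_damped_dist[OF assms]])
    also have "?S / norm (x - y) = 2 * (?S / (2 * norm (x - y)))"
      by (simp only: times_divide_eq_right mult_divide_mult_cancel_left[OF zero_neq_numeral[symmetric]])
    finally have "ennreal (damped_kernel s \<kappa> x y) \<le> ennreal (2 * (?S / (2 * norm (x - y))))"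
      by (rule ennreal_leI)
    also have "\<dots> = 2 * ennreal (?S / (2 * norm (x - y)))" using S by (subst ennreal_mult) auto
    also have "ennreal (?S / (2 * norm (x - y))) = coulomb_kernel s x y"
      unfolding coulomb_kernel_def using n S by (subst divide_ennreal[symmetric]) (auto simp: ennreal_mult)
    finally show ?thesis .
  qed
qed

definition damping :: "nat \<Rightarrow> real" where
  "damping n = 1 - 1 / real (Suc n)"

lemma damping: "0 \<le> damping n" "damping n < 1" "damping \<longlonglongrightarrow> 1"
proof -
  show "damping \<longlonglongrightarrow> 1"
    unfolding damping_def using tendsto_diff[OF tendsto_const LIMSEQ_inverse_real_of_nat, of 1]
    by (simp add: inverse_eq_divide)
qed (auto simp: damping_def)

text \<open>The condition on \<open>s\<close> concerns the origin: for \<open>s = 0\<close> the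
  numerator there is 2, the real quotient by zero is 0, but the extended quotient is
  infinite.\<close>

lemma damped_kernel_tendsto:
  assumes "s \<noteq> 0"
  shows "(\<lambda>n. ennreal (damped_kernel s (damping n) x y)) \<longlonglongrightarrow> coulomb_kernel s x y"
proof -
  let ?S = "rpow (norm x) s + rpow (norm y) s"
  have S: "?S \<ge> 0" by simp
  consider "?S = 0" | "?S > 0" "x = y" | "x \<noteq> y" using S by linarith
  then show ?thesis
  proof cases
    case 1
    then show ?thesis by (simp only: damped_kernel_def coulomb_kernel_def) simp
  next
    case 2
    \<comment> \<open>On the diagonal the damped distance shrinks like \<open>1 / (n + 1)\<close>,
      so the damped kernel grows linearly in \<open>n\<close> and tends to infinity.\<close>
    have "norm (x - damping n *\<^sub>R x) = norm x / real (Suc n)" for n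
    proof -
      have "x - damping n *\<^sub>R x = (1 / real (Suc n)) *\<^sub>R x" by (simp add: damping_def algebra_simps)
      then show ?thesis by simp
    qed
    then have v: "damped_kernel s (damping n) x y = ?S / (2 * norm x) * real (Suc n)" for n
      using 2 by (simp add: damped_kernel_def damped_dist_eq)
    show ?thesis
    proof (cases "x = 0")
      case True
      then show ?thesis using 2 assms by (simp add: rpow_def)
    next
      case False
      then have c: "?S / (2 * norm x) > 0" using 2 by simp
      have "filterlim (\<lambda>n. ?S / (2 * norm x) * real (Suc n)) at_top sequentially"
        by (rule filterlim_tendsto_pos_mult_at_top[OF tendsto_const c])
          (rule filterlim_compose[OF filterlim_real_sequentially filterlim_Suc])
      then have "(\<lambda>n. ennreal (damped_kernel s (damping n) x y)) \<longlonglongrightarrow> top"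
        unfolding v by (simp only: ennreal_tendsto_top_eq_at_top)
      then show ?thesis using 2 by (simp add: coulomb_kernel_def ennreal_divide_zero)
    qed
  next
    case 3
    then have n: "norm (x - y) > 0" by simp
    have "(\<lambda>n. damped_kernel s (damping n) x y) \<longlonglongrightarrow> ?S / (2 * norm (x - y))"
      unfolding damped_kernel_def using n by (intro tendsto_intros damped_dist_tendsto damping) auto
    moreover have "ennreal (?S / (2 * norm (x - y))) = coulomb_kernel s x y"
      unfolding coulomb_kernel_def using n S by (subst divide_ennreal[symmetric]) (auto simp: ennreal_mult)
    ultimately show ?thesis by (metis tendsto_ennrealI)
  qed
qed

lemma integral_power_series:
  fixes f :: "nat \<Rightarrow> 'a \<Rightarrow> real"
  assumes int: "\<And>l. integrable N (f l)" and W: "integrable N W"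
    and bound: "\<And>l z. \<bar>f l z\<bar> \<le> W z" and \<kappa>: "0 \<le> \<kappa>" "\<kappa> < 1"
    and sums: "\<And>z. (\<lambda>l. \<kappa> ^ l * f l z) sums g z"
  shows "integrable N g" "(\<lambda>l. \<kappa> ^ l * (\<integral>z. f l z \<partial>N)) sums (\<integral>z. g z \<partial>N)"
proof -
  have g: "g = (\<lambda>z. \<Sum>l. \<kappa> ^ l * f l z)" using sums by (auto simp: sums_iff)
  have i: "integrable N (\<lambda>z. \<kappa> ^ l * f l z)" for l using int by simp
  have b: "norm (\<kappa> ^ l * f l z) \<le> \<kappa> ^ l * W z" for l z
    using \<kappa> bound[of l z] by (auto simp: abs_mult power_abs intro!: mult_left_mono)
  have geo: "summable (\<lambda>l. \<kappa> ^ l * c)" for c :: real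
    using \<kappa> by (intro summable_mult2 summable_geometric) auto
  have s1: "AE z in N. summable (\<lambda>l. norm (\<kappa> ^ l * f l z))"
    by (intro AE_I2 summable_comparison_test'[OF geo]) (use b in auto)
  have "(\<integral>z. norm (\<kappa> ^ l * f l z) \<partial>N) \<le> \<kappa> ^ l * (\<integral>z. W z \<partial>N)" for l
  proof -
    have "(\<integral>z. norm (\<kappa> ^ l * f l z) \<partial>N) \<le> (\<integral>z. \<kappa> ^ l * W z \<partial>N)"
      using i W b by (intro integral_mono) auto
    then show ?thesis by simp
  qed
  then have s2: "summable (\<lambda>l. (\<integral>z. norm (\<kappa> ^ l * f l z) \<partial>N))"
    by (intro summable_comparison_test'[OF geo[of "\<integral>z. W z \<partial>N"]]) simp
  show "integrable N g" unfolding g by (rule integrable_suminf[OF i s1 s2])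
  show "(\<lambda>l. \<kappa> ^ l * (\<integral>z. f l z \<partial>N)) sums (\<integral>z. g z \<partial>N)"
    using sums_integral[OF i s1 s2] by (simp add: g)
qed

lemma legendre_term_0: "legendre_term s 0 x y = (rpow (norm x) s + rpow (norm y) s) / (2 * max (norm x) (norm y))"
  by (simp add: legendre_term_def)

lemma legendre_term_0_nonneg [simp]: "0 \<le> legendre_term s 0 x y"
  by (simp add: legendre_term_0 le_max_iff_disj)

lemma I_s_altdef: "I_s s M = (\<integral>\<^sup>+ z. coulomb_kernel s (fst z) (snd z) \<partial>(M \<Otimes>\<^sub>M M))"
  by (simp add: I_s_def coulomb_kernel_def)

text \<open>The comparison is made for each damping factor and survives the limit. Dominated
  convergence, with twice the original kernel as majorant, is available once \<open>I_s s M\<close>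
  is finite; no monotonicity in \<kappa> is used.\<close>

lemma I_s_ge_radial_part:
  assumes H: "haar_SO3 H" and M: "prob_space M" and sets [measurable_cong]: "sets M = sets borel" and fin: "moment s M < \<infinity>"
    and s: "1 \<le> s" "s \<le> 3"
  shows "(\<integral>\<^sup>+ z. ennreal (legendre_term s 0 (fst z) (snd z)) \<partial>(M \<Otimes>\<^sub>M M)) \<le> I_s s M"
proof (cases "I_s s M = \<infinity>")
  case False
  let ?W = "\<lambda>z::(real^3) \<times> (real^3). rpow (norm (fst z)) (s - 1) + rpow (norm (snd z)) (s - 1)"
  have W: "integrable (M \<Otimes>\<^sub>M M) ?W"
  proof (rule integrableI_bounded)
    show "(\<integral>\<^sup>+ z. ennreal (norm (?W z)) \<partial>(M \<Otimes>\<^sub>M M)) < \<infinity>"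
      using moment_pair_finite[OF M sets fin] by simp
  qed measurable
  have "(\<integral>\<^sup>+ z. ennreal (legendre_term s 0 (fst z) (snd z)) \<partial>(M \<Otimes>\<^sub>M M))
      \<le> (\<integral>\<^sup>+ z. ennreal (damped_kernel s (damping n) (fst z) (snd z)) \<partial>(M \<Otimes>\<^sub>M M))" for n
  proof -
    let ?f = "\<lambda>l z. legendre_term s l (fst z) (snd z)"
    let ?g = "\<lambda>z. damped_kernel s (damping n) (fst z) (snd z)"
    note series = integral_power_series[where f="?f" and N="M \<Otimes>\<^sub>M M" and g="?g", OF legendre_term_integrable[OF M sets fin s(1)] W legendre_term_bound[OF s(1)] damping(1,2)[of n] damped_kernel_sums[OF damping(1,2)]]
    \<comment> \<open>The term \<open>l = 0\<close> is a partial sum of a series whose remaining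
      terms are nonnegative, and its damping factor is \<open>\<kappa>^0 = 1\<close>.\<close>
    have "(\<Sum>l<1. damping n ^ l * (\<integral>z. ?f l z \<partial>(M \<Otimes>\<^sub>M M))) \<le> (\<Sum>l. damping n ^ l * (\<integral>z. ?f l z \<partial>(M \<Otimes>\<^sub>M M)))"
      using legendre_term_integral_nonneg[OF H M sets fin s] damping(1)[of n]
      by (intro sum_le_suminf sums_summable[OF series(2)]) (auto simp: Suc_le_eq)
    then have "(\<integral>z. ?f 0 z \<partial>(M \<Otimes>\<^sub>M M)) \<le> (\<integral>z. ?g z \<partial>(M \<Otimes>\<^sub>M M))"
      using sums_unique[OF series(2)] by simp
    then show ?thesis
      using legendre_term_integrable[OF M sets fin s(1), of 0] series(1)
      by (subst (1 2) nn_integral_eq_integral) (auto intro!: ennreal_leI)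
  qed
  moreover have "(\<lambda>n. \<integral>\<^sup>+ z. ennreal (damped_kernel s (damping n) (fst z) (snd z)) \<partial>(M \<Otimes>\<^sub>M M)) \<longlonglongrightarrow> I_s s M"
    unfolding I_s_altdef
  proof (rule nn_integral_dominated_convergence[where w="\<lambda>z. 2 * coulomb_kernel s (fst z) (snd z)"])
    show "(\<integral>\<^sup>+ z. 2 * coulomb_kernel s (fst z) (snd z) \<partial>(M \<Otimes>\<^sub>M M)) < \<infinity>"
      using False by (subst nn_integral_cmult) (auto simp: I_s_altdef[symmetric] ennreal_mult_less_top less_top)
  qed (use s in \<open>auto intro!: damped_kernel_le_coulomb_kernel damped_kernel_tendsto damping less_imp_le[OF damping(2)]\<close>)
  ultimately show ?thesis by (intro LIMSEQ_le_const) auto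
qed simp

text \<open>In substance Newton's shell theorem. With damping the mean is exact, since every degree
  \<open>l \<ge> 1\<close> averages to zero; Fatou's lemma then gives the inequality in the
  limit.\<close>

lemma haar_coulomb_kernel_mean_le:
  assumes H: "haar_SO3 H" and s: "1 \<le> s"
  shows "(\<integral>\<^sup>+ V. coulomb_kernel s x (V *v y) \<partial>H) \<le> ennreal (legendre_term s 0 x y)"
proof -
  note haar_sets[OF H, measurable_cong]
  interpret H: prob_space H using H by (rule haar_prob_space)
  have "(\<integral>\<^sup>+ V. ennreal (damped_kernel s (damping n) x (V *v y)) \<partial>H) = ennreal (legendre_term s 0 x y)" for n
  proof -
    let ?W = "\<lambda>V. rpow (norm x) (s - 1) + rpow (norm (V *v y)) (s - 1)"
    have W: "integrable H ?W"
      by (rule haar_integrable_bounded[OF H, of _ "rpow (norm x) (s - 1) + rpow (norm y) (s - 1)"]) auto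
    have int: "integrable H (\<lambda>V. legendre_term s l x (V *v y))" for l
    proof (rule haar_integrable_bounded[OF H])
      fix U :: "real^3^3" assume "U \<in> SO3"
      then show "norm (legendre_term s l x (U *v y)) \<le> rpow (norm x) (s - 1) + rpow (norm y) (s - 1)"
        using legendre_term_bound[OF s, of l x "U *v y"] by simp
    qed measurable
    have val: "(\<integral>V. legendre_term s l x (V *v y) \<partial>H) = (if l = 0 then legendre_term s 0 x y else 0)" for l
    proof -
      have "(\<integral>V. legendre_term s l x (V *v y) \<partial>H) = (\<integral>V. (rpow (norm x) s + rpow (norm y) s) / (2 * max (norm x) (norm y))
          * (legendre_form l (x \<bullet> (V *v y)) ((x \<bullet> x) * (y \<bullet> y)) / max (norm x) (norm y) ^ (2*l)) \<partial>H)"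
      proof (rule integral_cong_AE)
        show "AE V in H. legendre_term s l x (V *v y) = (rpow (norm x) s + rpow (norm y) s) / (2 * max (norm x) (norm y))
          * (legendre_form l (x \<bullet> (V *v y)) ((x \<bullet> x) * (y \<bullet> y)) / max (norm x) (norm y) ^ (2*l))"
          using haar_AE_SO3[OF H] by eventually_elim (simp add: legendre_term_def SO3_inner)
      qed (rule haar_measurable[OF H], measurable)+
      also have "\<dots> = (rpow (norm x) s + rpow (norm y) s) / (2 * max (norm x) (norm y))
          * ((\<integral>V. legendre_form l (x \<bullet> (V *v y)) ((x \<bullet> x) * (y \<bullet> y)) \<partial>H) / max (norm x) (norm y) ^ (2*l))"
        by (simp only: integral_mult_right_zero integral_divide_zero)
      also have "\<dots> = (if l = 0 then legendre_term s 0 x y else 0)"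
        using haar_legendre_form_mean[OF H, of l x y] by (auto simp: legendre_term_0 H.prob_space)
      finally show ?thesis .
    qed
    note series = integral_power_series[where f="\<lambda>l V. legendre_term s l x (V *v y)" and N=H and g="\<lambda>V. damped_kernel s (damping n) x (V *v y)",
        OF int W legendre_term_bound[OF s] damping(1,2)[of n] damped_kernel_sums[OF damping(1,2)]]
    have "(\<lambda>l. damping n ^ l * (\<integral>V. legendre_term s l x (V *v y) \<partial>H)) = (\<lambda>l. if l = 0 then legendre_term s 0 x y else 0)"
      by (auto simp: val)
    then have "(\<integral>V. damped_kernel s (damping n) x (V *v y) \<partial>H) = legendre_term s 0 x y"
      using series(2) sums_single[of 0 "\<lambda>_. legendre_term s 0 x y"] by (metis (no_types, lifting) sums_unique2)
    then show ?thesis using series(1) by (subst nn_integral_eq_integral) auto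
  qed
  moreover have "(\<integral>\<^sup>+ V. coulomb_kernel s x (V *v y) \<partial>H) = (\<integral>\<^sup>+ V. liminf (\<lambda>n. ennreal (damped_kernel s (damping n) x (V *v y))) \<partial>H)"
    using lim_imp_Liminf[OF _ damped_kernel_tendsto] s by (intro nn_integral_cong) simp
  moreover have "\<dots> \<le> liminf (\<lambda>n. \<integral>\<^sup>+ V. ennreal (damped_kernel s (damping n) x (V *v y)) \<partial>H)"
    by (rule nn_integral_liminf) measurable
  ultimately show ?thesis by (simp add: Liminf_const)
qed

section \<open>Averaging a measure over rotations\<close>

text \<open>The law of \<open>U x\<close> rather than \<open>U^{-1} x\<close>: as
  \<open>V (U x) = (V U) x\<close>, the left invariance of \<open>H\<close> gives rotation
  invariance at once.\<close>

definition rotation_average :: "(real^3^3) measure \<Rightarrow> (real^3) measure \<Rightarrow> (real^3) measure" where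
  "rotation_average H M = distr (H \<Otimes>\<^sub>M M) borel (\<lambda>p. fst p *v snd p)"

lemma sets_rotation_average [simp, measurable_cong]: "sets (rotation_average H M) = sets borel"
  by (simp add: rotation_average_def)

lemma measurable_rotation_pair:
  assumes H: "haar_SO3 H" and sets: "sets M = sets borel"
  shows "(\<lambda>p. fst p *v snd p) \<in> (H \<Otimes>\<^sub>M M) \<rightarrow>\<^sub>M borel"
proof -
  note haar_sets[OF H, measurable_cong] sets[measurable_cong]
  have [measurable]: "fst \<in> borel_measurable (H \<Otimes>\<^sub>M M)" "snd \<in> borel_measurable (H \<Otimes>\<^sub>M M)" by measurable
  show ?thesis by measurable
qed

lemma prob_space_rotation_average:
  assumes H: "haar_SO3 H" and M: "prob_space M" and sets: "sets M = sets borel"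
  shows "prob_space (rotation_average H M)"
proof -
  interpret M: prob_space M by fact
  interpret H: prob_space H using H by (rule haar_prob_space)
  interpret HM: pair_prob_space H M ..
  show ?thesis unfolding rotation_average_def
    by (rule HM.prob_space_distr[OF measurable_rotation_pair[OF H sets]])
qed

lemma nn_integral_rotation_average:
  assumes H: "haar_SO3 H" and M: "prob_space M" and sets: "sets M = sets borel" and f [measurable]: "f \<in> borel_measurable borel"
  shows "(\<integral>\<^sup>+ x. f x \<partial>rotation_average H M) = (\<integral>\<^sup>+ U. (\<integral>\<^sup>+ x. f (U *v x) \<partial>M) \<partial>H)"
    and "(\<integral>\<^sup>+ x. f x \<partial>rotation_average H M) = (\<integral>\<^sup>+ x. (\<integral>\<^sup>+ U. f (U *v x) \<partial>H) \<partial>M)"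
proof -
  interpret M: prob_space M by fact
  interpret H: prob_space H using H by (rule haar_prob_space)
  interpret HM: pair_prob_space H M ..
  note [measurable] = measurable_rotation_pair[OF H sets]
  have "(\<integral>\<^sup>+ x. f x \<partial>rotation_average H M) = (\<integral>\<^sup>+ p. f (fst p *v snd p) \<partial>(H \<Otimes>\<^sub>M M))"
    unfolding rotation_average_def by (rule nn_integral_distr) measurable
  moreover have "(\<integral>\<^sup>+ U. (\<integral>\<^sup>+ x. f (U *v x) \<partial>M) \<partial>H) = (\<integral>\<^sup>+ p. f (fst p *v snd p) \<partial>(H \<Otimes>\<^sub>M M))"
    by (subst M.nn_integral_fst[symmetric]) auto
  moreover have "(\<integral>\<^sup>+ x. (\<integral>\<^sup>+ U. f (U *v x) \<partial>H) \<partial>M) = (\<integral>\<^sup>+ p. f (fst p *v snd p) \<partial>(H \<Otimes>\<^sub>M M))"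
    by (subst HM.nn_integral_snd[symmetric]) auto
  ultimately show "(\<integral>\<^sup>+ x. f x \<partial>rotation_average H M) = (\<integral>\<^sup>+ U. (\<integral>\<^sup>+ x. f (U *v x) \<partial>M) \<partial>H)"
    and "(\<integral>\<^sup>+ x. f x \<partial>rotation_average H M) = (\<integral>\<^sup>+ x. (\<integral>\<^sup>+ U. f (U *v x) \<partial>H) \<partial>M)" by simp_all
qed

lemma nn_integral_rotation_average_invariant:
  assumes H: "haar_SO3 H" and M: "prob_space M" and sets: "sets M = sets borel" and f [measurable]: "f \<in> borel_measurable borel"
    and inv: "\<And>U x. U \<in> SO3 \<Longrightarrow> f (U *v x) = f x"
  shows "(\<integral>\<^sup>+ x. f x \<partial>rotation_average H M) = (\<integral>\<^sup>+ x. f x \<partial>M)"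
proof -
  interpret H: prob_space H using H by (rule haar_prob_space)
  have "(\<integral>\<^sup>+ x. f x \<partial>rotation_average H M) = (\<integral>\<^sup>+ U. (\<integral>\<^sup>+ x. f (U *v x) \<partial>M) \<partial>H)"
    by (rule nn_integral_rotation_average(1)[OF H M sets f])
  also have "\<dots> = (\<integral>\<^sup>+ U. (\<integral>\<^sup>+ x. f x \<partial>M) \<partial>H)"
    by (rule nn_integral_cong_AE) (use haar_AE_SO3[OF H] in eventually_elim, simp add: inv)
  finally show ?thesis by (simp add: H.emeasure_space_1)
qed

lemma moment_rotation_average:
  assumes "haar_SO3 H" "prob_space M" "sets M = sets borel"
  shows "moment s (rotation_average H M) = moment s M"
  unfolding moment_def using assms by (rule nn_integral_rotation_average_invariant) auto

text \<open>Averaging the second variable alone already bounds the kernel by the term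
  \<open>l = 0\<close>. That term depends on norms only, so the average in the first variable leaves
  it unchanged.\<close>

lemma I_s_rotation_average_le:
  assumes H: "haar_SO3 H" and M: "prob_space M" and sets [measurable_cong]: "sets M = sets borel" and s: "1 \<le> s"
  shows "I_s s (rotation_average H M) \<le> (\<integral>\<^sup>+ z. ennreal (legendre_term s 0 (fst z) (snd z)) \<partial>(M \<Otimes>\<^sub>M M))"
proof -
  interpret M: prob_space M by fact
  let ?A = "rotation_average H M"
  interpret A: prob_space ?A by (rule prob_space_rotation_average[OF H M sets])
  have "I_s s ?A = (\<integral>\<^sup>+ x. (\<integral>\<^sup>+ y. coulomb_kernel s x y \<partial>?A) \<partial>?A)"
    unfolding I_s_altdef by (subst A.nn_integral_fst[symmetric]) auto
  also have "\<dots> = (\<integral>\<^sup>+ x. (\<integral>\<^sup>+ y. (\<integral>\<^sup>+ V. coulomb_kernel s x (V *v y) \<partial>H) \<partial>M) \<partial>?A)"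
    by (intro nn_integral_cong nn_integral_rotation_average(2)[OF H M sets]) auto
  also have "\<dots> \<le> (\<integral>\<^sup>+ x. (\<integral>\<^sup>+ y. ennreal (legendre_term s 0 x y) \<partial>M) \<partial>?A)"
    by (intro nn_integral_mono haar_coulomb_kernel_mean_le[OF H s])
  also have "\<dots> = (\<integral>\<^sup>+ x. (\<integral>\<^sup>+ y. ennreal (legendre_term s 0 x y) \<partial>M) \<partial>M)"
    by (rule nn_integral_rotation_average_invariant[OF H M sets]) (auto simp: legendre_term_0)
  also have "\<dots> = (\<integral>\<^sup>+ z. ennreal (legendre_term s 0 (fst z) (snd z)) \<partial>(M \<Otimes>\<^sub>M M))"
    by (subst M.nn_integral_fst[symmetric]) auto
  finally show ?thesis .
qed

section \<open>Radial measures\<close>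

lemma haar_nn_integral_mult:
  assumes "haar_SO3 H" "V \<in> SO3" and [measurable]: "f \<in> borel_measurable borel"
  shows "(\<integral>\<^sup>+ U. f (V ** U) \<partial>H) = (\<integral>\<^sup>+ U. f U \<partial>H)"
proof -
  have "(\<integral>\<^sup>+ U. f U \<partial>H) = (\<integral>\<^sup>+ U. f U \<partial>distr H borel (\<lambda>U. V ** U))"
    using assms(1,2) by (simp add: haar_SO3_def)
  also have "\<dots> = (\<integral>\<^sup>+ U. f (V ** U) \<partial>H)"
    using borel_measurable_matrix_matrix_mult[of "\<lambda>_. V" borel "\<lambda>U. U"]
    by (subst nn_integral_distr) (auto intro!: haar_measurable[OF assms(1)])
  finally show ?thesis ..
qed

lemma distr_rotation_average:
  assumes H: "haar_SO3 H" and M: "prob_space M" and sets: "sets M = sets borel" and V: "V \<in> SO3"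
  shows "distr (rotation_average H M) borel (\<lambda>x. V *v x) = rotation_average H M"
proof (rule measure_eqI)
  fix X assume "X \<in> sets (distr (rotation_average H M) borel (\<lambda>x. V *v x))"
  then have X [measurable]: "X \<in> sets borel" by simp
  have m [measurable]: "(\<lambda>x. V *v x) \<in> borel_measurable borel"
    using borel_measurable_matrix_vector_mult[of "\<lambda>_. V" borel "\<lambda>x. x"] by simp
  have "emeasure (distr (rotation_average H M) borel (\<lambda>x. V *v x)) X = (\<integral>\<^sup>+ x. indicator X x \<partial>distr (rotation_average H M) borel (\<lambda>x. V *v x))"
    by simp
  also have "\<dots> = (\<integral>\<^sup>+ x. indicator X (V *v x) \<partial>rotation_average H M)"
    by (rule nn_integral_distr) measurable
  also have "\<dots> = (\<integral>\<^sup>+ x. (\<integral>\<^sup>+ U. indicator X ((V ** U) *v x) \<partial>H) \<partial>M)"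
    by (subst nn_integral_rotation_average(2)[OF H M sets]) (auto simp: matrix_vector_mul_assoc)
  also have "\<dots> = (\<integral>\<^sup>+ x. (\<integral>\<^sup>+ U. indicator X (U *v x) \<partial>H) \<partial>M)"
    by (intro nn_integral_cong haar_nn_integral_mult[OF H V, of "\<lambda>U. indicator X (U *v _)"]) measurable
  also have "\<dots> = (\<integral>\<^sup>+ x. indicator X x \<partial>rotation_average H M)"
    by (rule nn_integral_rotation_average(2)[OF H M sets, symmetric]) measurable
  also have "\<dots> = emeasure (rotation_average H M) X" by simp
  finally show "emeasure (distr (rotation_average H M) borel (\<lambda>x. V *v x)) X = emeasure (rotation_average H M) X" .
qed simp

lemma matrix_inv_SO3: "U \<in> SO3 \<Longrightarrow> matrix_inv U = transpose U"
proof -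
  assume U: "U \<in> SO3"
  then have t: "U ** transpose U = mat 1" "transpose U ** U = mat 1"
    by (auto simp: SO3_def orthogonal_matrix_def)
  have "U ** matrix_inv U = mat 1 \<and> matrix_inv U ** U = mat 1"
    unfolding matrix_inv_def by (rule someI[of _ "transpose U"]) (use t in simp)
  then show "matrix_inv U = transpose U"
    using t by (metis matrix_mul_assoc matrix_mul_lid matrix_mul_rid)
qed

text \<open>\<open>radial\<close> integrates \<open>matrix_inv\<close> over a measure on all
  matrices, so measurability is needed off the rotation group too. Cramer's rule covers the
  invertible matrices.\<close>

lemma borel_measurable_matrix_inv_mult:
  fixes x :: "real^'n"
  shows "(\<lambda>U::real^'n^'n. matrix_inv U *v x) \<in> borel_measurable borel"
proof -
  have d: "(\<lambda>U::real^'n^'n. det U) \<in> borel_measurable borel"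
    unfolding det_def by (intro borel_measurable_continuous_onI continuous_intros)
  have n: "(\<lambda>U::real^'n^'n. (\<chi> k. det (\<chi> i j. if j = k then x $ i else U $ i $ j)) :: real^'n) \<in> borel_measurable borel"
  proof (intro borel_measurable_continuous_onI continuous_on_vec_lambda)
    fix k
    have "continuous_on UNIV (\<lambda>U::real^'n^'n. if j = k then x $ i else U $ i $ j)" for i j
      by (cases "j = k") (auto intro!: continuous_intros)
    then show "continuous_on UNIV (\<lambda>U::real^'n^'n. det (\<chi> i j. if j = k then x $ i else U $ i $ j))"
      unfolding det_def by (auto intro!: continuous_intros)
  qed
  \<comment> \<open>For singular \<open>U\<close> the predicate under the choice operator in
    \<open>matrix_inv U\<close> is constantly false, so all singular matrices share this one default
    value.\<close>
  define B :: "real^'n^'n" where "B = (SOME A. False)"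
  have "matrix_inv U *v x = (if det U = 0 then B *v x else (1 / det U) *\<^sub>R (\<chi> k. det (\<chi> i j. if j = k then x $ i else U $ i $ j)))" for U :: "real^'n^'n"
  proof (cases "det U = 0")
    case True
    then have "\<not> (U ** A = mat 1 \<and> A ** U = mat 1)" for A
      using invertible_det_nz[of U] by (auto simp: invertible_def)
    then have "(\<lambda>A. U ** A = mat 1 \<and> A ** U = mat 1) = (\<lambda>_. False)" by blast
    then have "matrix_inv U = B" unfolding matrix_inv_def B_def by (rule arg_cong[where f=Eps])
    then show ?thesis using True by simp
  next
    case False
    then obtain A where "U ** A = mat 1" "A ** U = mat 1"
      using invertible_det_nz[of U] by (auto simp: invertible_def)
    then have "U ** matrix_inv U = mat 1 \<and> matrix_inv U ** U = mat 1"
      unfolding matrix_inv_def by (intro someI_ex[where P="\<lambda>A. U ** A = mat 1 \<and> A ** U = mat 1"] exI[of _ A] conjI)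
    then have "U *v (matrix_inv U *v x) = x" by (simp add: matrix_vector_mul_assoc)
    then have "matrix_inv U *v x = (\<chi> k. det (\<chi> i j. if j = k then x $ i else U $ i $ j) / det U)"
      by (rule iffD1[OF cramer[OF False]])
    also have "\<dots> = (1 / det U) *\<^sub>R (\<chi> k. det (\<chi> i j. if j = k then x $ i else U $ i $ j))"
      by (simp add: vec_eq_iff)
    finally show ?thesis using False by (simp only: if_False)
  qed
  moreover have "(\<lambda>U::real^'n^'n. if det U = 0 then B *v x else (1 / det U) *\<^sub>R (\<chi> k. det (\<chi> i j. if j = k then x $ i else U $ i $ j))) \<in> borel_measurable borel"
    using d n by measurable
  ultimately show ?thesis by simp
qed

text \<open>The averaging measure \<open>H\<close> and the test measure \<open>H'\<close> may be
  different. Uniqueness of Haar measure is avoided: the average is invariant under each single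
  rotation, so integrating over \<open>H'\<close> changes nothing.\<close>

lemma radial_rotation_average:
  assumes H: "haar_SO3 H" and M: "prob_space M" and sets: "sets M = sets borel"
  shows "radial (rotation_average H M)"
  unfolding radial_def
proof (intro allI impI, elim conjE)
  fix H' and f :: "real^3 \<Rightarrow> real"
  assume H': "haar_SO3 H'" and f [measurable]: "f \<in> borel_measurable borel" and "bounded (range f)"
  then obtain B where B: "\<And>x. \<bar>f x\<bar> \<le> B" by (auto simp: bounded_iff)
  let ?A = "rotation_average H M"
  interpret A: prob_space ?A by (rule prob_space_rotation_average[OF H M sets])
  interpret H': prob_space H' using H' by (rule haar_prob_space)
  interpret HA: pair_prob_space H' ?A ..
  have [measurable]: "(\<lambda>x. U *v x) \<in> borel_measurable borel" for U :: "real^3^3"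
    using borel_measurable_matrix_vector_mult[of "\<lambda>_. U" borel "\<lambda>x. x"] by simp
  note haar_sets[OF H', measurable_cong]
  have meas: "(\<lambda>(U, x). f (transpose U *v x)) \<in> borel_measurable (H' \<Otimes>\<^sub>M ?A)"
  proof -
    have [measurable]: "fst \<in> borel_measurable (H' \<Otimes>\<^sub>M ?A)" "snd \<in> borel_measurable (H' \<Otimes>\<^sub>M ?A)" by measurable
    show ?thesis unfolding split_beta' by measurable
  qed
  have "(\<integral>x. (\<integral>U. f (matrix_inv U *v x) \<partial>H') \<partial>?A) = (\<integral>x. (\<integral>U. f (transpose U *v x) \<partial>H') \<partial>?A)"
  proof (rule Bochner_Integration.integral_cong[OF refl], rule integral_cong_AE)
    fix x
    show "(\<lambda>U. f (matrix_inv U *v x)) \<in> borel_measurable H'"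
      by (rule haar_measurable[OF H'], rule measurable_compose[OF borel_measurable_matrix_inv_mult f])
    show "(\<lambda>U. f (transpose U *v x)) \<in> borel_measurable H'"
      by (rule haar_measurable[OF H']) measurable
    show "AE U in H'. f (matrix_inv U *v x) = f (transpose U *v x)"
      using haar_AE_SO3[OF H'] by eventually_elim (simp add: matrix_inv_SO3)
  qed
  also have "\<dots> = (\<integral>U. (\<integral>x. f (transpose U *v x) \<partial>?A) \<partial>H')"
    by (rule HA.Fubini_integral) (rule HA.P.integrable_const_bound[where B=B], use B meas in auto)
  also have "\<dots> = (\<integral>U. (\<integral>x. f x \<partial>?A) \<partial>H')"
  proof (rule integral_cong_AE)
    show "AE U in H'. (\<integral>x. f (transpose U *v x) \<partial>?A) = (\<integral>x. f x \<partial>?A)"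
      using haar_AE_SO3[OF H']
    proof eventually_elim
      case (elim U)
      have "(\<integral>x. f x \<partial>?A) = (\<integral>x. f x \<partial>distr ?A borel (\<lambda>x. transpose U *v x))"
        by (simp only: distr_rotation_average[OF H M sets SO3_transpose[OF elim]])
      also have "\<dots> = (\<integral>x. f (transpose U *v x) \<partial>?A)" by (rule integral_distr) measurable
      finally show ?case ..
    qed
    show "(\<lambda>U. \<integral>x. f (transpose U *v x) \<partial>?A) \<in> borel_measurable H'"
      by (rule A.borel_measurable_lebesgue_integral[OF meas])
  qed simp
  also have "\<dots> = (\<integral>x. f x \<partial>?A)" by (simp add: H'.prob_space)
  finally show "(\<integral>x. f x \<partial>?A) = (\<integral>x. (\<integral>U. f (matrix_inv U *v x) \<partial>H') \<partial>?A)" ..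
qed

section \<open>Rotations, Fourier transforms and the Sobolev condition\<close>

lemma distr_lborel_SO3:
  assumes U: "U \<in> SO3"
  shows "distr lborel borel (\<lambda>x. U *v x) = lborel"
proof (rule lborel_eqI[symmetric])
  have m [measurable]: "(\<lambda>x. U *v x) \<in> borel_measurable borel"
    using borel_measurable_matrix_vector_mult[of "\<lambda>_. U" borel "\<lambda>x. x"] by simp
  fix l u :: "real^3" assume le: "\<And>b. b \<in> Basis \<Longrightarrow> l \<bullet> b \<le> u \<bullet> b"
  let ?g = "\<lambda>x. transpose U *v x"
  have g: "orthogonal_transformation ?g"
    using SO3_transpose[OF U] by (simp add: orthogonal_transformation_matrix SO3_def del: transpose_matrix_vector)
  have inv: "U *v (transpose U *v x) = x" "transpose U *v (U *v x) = x" for x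
    using U unfolding SO3_def orthogonal_matrix_def matrix_vector_mul_assoc by simp_all
  have im: "(\<lambda>x. U *v x) -` box l u = ?g ` box l u"
  proof (intro set_eqI iffI)
    fix x assume "x \<in> (\<lambda>x. U *v x) -` box l u"
    then show "x \<in> ?g ` box l u" by (intro image_eqI[of x ?g "U *v x"]) (simp_all only: inv vimage_eq)
  next
    fix x assume "x \<in> ?g ` box l u"
    then obtain y where "y \<in> box l u" "x = ?g y" by (rule imageE)
    then show "x \<in> (\<lambda>x. U *v x) -` box l u" by (simp only: inv vimage_eq)
  qed
  have "emeasure (distr lborel borel (\<lambda>x. U *v x)) (box l u) = emeasure lborel (?g ` box l u)"
    by (subst emeasure_distr) (auto simp: im)
  also have "?g ` box l u \<in> sets borel" unfolding im[symmetric] using measurable_sets[OF m, of "box l u"] by simp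
  then have "emeasure lborel (?g ` box l u) = emeasure lebesgue (?g ` box l u)" by simp
  also have "\<dots> = ennreal (measure lebesgue (?g ` box l u))"
    using measurable_orthogonal_image[OF g lmeasurable_box] by (intro emeasure_eq_measure2 fmeasurableD2) 
  also have "\<dots> = ennreal (measure lebesgue (box l u))"
    by (simp only: measure_orthogonal_image[OF g lmeasurable_box])
  also have "\<dots> = (\<Prod>b\<in>Basis. (u - l) \<bullet> b)"
    using le by (simp add: measure_lborel_box)
  finally show "emeasure (distr lborel borel (\<lambda>x. U *v x)) (box l u) = (\<Prod>b\<in>Basis. (u - l) \<bullet> b)" .
qed simp

lemma borel_measurable_cis [measurable (raw)]:
  assumes "f \<in> borel_measurable M"
  shows "(\<lambda>w. cis (f w)) \<in> borel_measurable M"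
  using assms by (rule borel_measurable_continuous_on[rotated]) (intro continuous_intros)

lemma borel_measurable_fourier_meas:
  assumes M: "prob_space M" and sets: "sets M = sets borel"
  shows "fourier_meas M \<in> borel_measurable borel"
proof -
  interpret M: prob_space M by fact
  note sets[measurable_cong]
  have "(\<lambda>(k, x). cis (- (k \<bullet> x))) \<in> borel_measurable (borel \<Otimes>\<^sub>M M)"
  proof -
    have [measurable]: "fst \<in> borel_measurable (borel \<Otimes>\<^sub>M M)" "snd \<in> borel_measurable (borel \<Otimes>\<^sub>M M)" by measurable
    show ?thesis unfolding split_beta' by measurable
  qed
  then have "(\<lambda>k. \<integral>x. cis (- (k \<bullet> x)) \<partial>M) \<in> borel_measurable borel"
    by (rule M.borel_measurable_lebesgue_integral)
  then show ?thesis by (simp add: fourier_meas_def[abs_def])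
qed

lemma cmod_fourier_meas_le_1:
  assumes M: "prob_space M"
  shows "cmod (fourier_meas M k) \<le> 1"
proof -
  interpret M: prob_space M by fact
  have "cmod (fourier_meas M k) \<le> (\<integral>x. cmod (cis (- (k \<bullet> x))) \<partial>M)"
    unfolding fourier_meas_def by (rule integral_norm_bound)
  then show ?thesis by (simp add: M.prob_space)
qed

text \<open>Jensen's inequality for the square, read off from the nonnegativity of the variance of
  \<open>cmod (g x)\<close>.\<close>

lemma (in prob_space) norm_integral_power2_le:
  fixes g :: "'a \<Rightarrow> complex"
  assumes [measurable]: "g \<in> borel_measurable M" and b: "\<And>x. cmod (g x) \<le> B"
  shows "(cmod (\<integral>x. g x \<partial>M))\<^sup>2 \<le> (\<integral>x. (cmod (g x))\<^sup>2 \<partial>M)"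
proof -
  have i1: "integrable M (\<lambda>x. cmod (g x))" by (rule integrable_const_bound[where B=B]) (use b in auto)
  have i2: "integrable M (\<lambda>x. (cmod (g x))\<^sup>2)"
    by (rule integrable_const_bound[where B="B\<^sup>2"]) (use b in \<open>auto intro!: power_mono\<close>)
  have "(cmod (\<integral>x. g x \<partial>M))\<^sup>2 \<le> (\<integral>x. cmod (g x) \<partial>M)\<^sup>2"
    by (intro power_mono integral_norm_bound) auto
  also have "\<dots> \<le> (\<integral>x. (cmod (g x))\<^sup>2 \<partial>M)"
    using variance_eq[OF i1 i2] variance_positive[of "\<lambda>x. cmod (g x)"] by simp
  finally show ?thesis .
qed

lemma fourier_meas_rotation_average:
  assumes H: "haar_SO3 H" and M: "prob_space M" and sets: "sets M = sets borel"
  shows "fourier_meas (rotation_average H M) k = (\<integral>U. fourier_meas M (transpose U *v k) \<partial>H)"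
proof -
  interpret M: prob_space M by fact
  interpret H: prob_space H using H by (rule haar_prob_space)
  interpret HM: pair_prob_space H M ..
  note [measurable] = measurable_rotation_pair[OF H sets]
  have "fourier_meas (rotation_average H M) k = (\<integral>p. cis (- (k \<bullet> (fst p *v snd p))) \<partial>(H \<Otimes>\<^sub>M M))"
    unfolding fourier_meas_def rotation_average_def by (rule integral_distr) measurable
  also have "\<dots> = (\<integral>U. (\<integral>x. cis (- (k \<bullet> (U *v x))) \<partial>M) \<partial>H)"
    by (subst HM.integral_fst'[symmetric]) (auto intro!: HM.P.integrable_const_bound[where B=1])
  also have "\<dots> = (\<integral>U. fourier_meas M (transpose U *v k) \<partial>H)"
  proof -
    have "k \<bullet> (U *v x) = (transpose U *v k) \<bullet> x" for U :: "real^3^3" and x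
      using inner_matrix_vector_left[of U x k] by (simp add: inner_commute)
    then show ?thesis by (simp add: fourier_meas_def)
  qed
  finally show ?thesis .
qed

text \<open>The transform of the average is the mean of rotated transforms, so by Jensen its square
  is at most the mean of their squares. The weight \<open>1 / (1 + |k|^2)\<close> and Lebesgue
  measure are rotation invariant, so after exchanging integrals each rotation contributes the same
  value.\<close>

lemma D_s_rotation_average:
  assumes H: "haar_SO3 H" and D: "D_s s M"
  shows "D_s s (rotation_average H M)"
proof -
  have M: "prob_space M" and sets: "sets M = sets borel" and fin: "moment s M < \<infinity>"
    and four: "(\<integral>\<^sup>+ k. ennreal ((cmod (fourier_meas M k))\<^sup>2 / (1 + (norm k)\<^sup>2)) \<partial>lborel) < \<infinity>"
    using D by (auto simp: D_s_def borel_prob_def)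
  let ?A = "rotation_average H M"
  interpret H: prob_space H using H by (rule haar_prob_space)
  interpret HL: pair_sigma_finite H lborel ..
  note haar_sets[OF H, measurable_cong]
  note F [measurable] = borel_measurable_fourier_meas[OF M sets]
  have mk [measurable]: "(\<lambda>U::real^3^3. transpose U *v k) \<in> borel_measurable borel" for k by measurable
  have pair: "(\<lambda>(U, k). ennreal ((cmod (fourier_meas M (transpose U *v k)))\<^sup>2 / (1 + (norm k)\<^sup>2))) \<in> borel_measurable (H \<Otimes>\<^sub>M lborel)"
  proof -
    have [measurable]: "fst \<in> borel_measurable (H \<Otimes>\<^sub>M lborel)" "snd \<in> borel_measurable (H \<Otimes>\<^sub>M lborel)" by measurable
    show ?thesis unfolding split_beta' by measurable
  qed
  have "(\<integral>\<^sup>+ k. ennreal ((cmod (fourier_meas ?A k))\<^sup>2 / (1 + (norm k)\<^sup>2)) \<partial>lborel)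
    \<le> (\<integral>\<^sup>+ k. (\<integral>\<^sup>+ U. ennreal ((cmod (fourier_meas M (transpose U *v k)))\<^sup>2 / (1 + (norm k)\<^sup>2)) \<partial>H) \<partial>lborel)"
  proof (rule nn_integral_mono)
    fix k :: "real^3"
    have g: "(\<lambda>U. fourier_meas M (transpose U *v k)) \<in> borel_measurable H"
      by (rule haar_measurable[OF H]) measurable
    have i: "integrable H (\<lambda>U. (cmod (fourier_meas M (transpose U *v k)))\<^sup>2 / (1 + (norm k)\<^sup>2))"
    proof (rule haar_integrable_bounded[OF H])
      fix U
      have "(cmod (fourier_meas M (transpose U *v k)))\<^sup>2 \<le> 1"
        using cmod_fourier_meas_le_1[OF M] by (intro power_le_one) auto
      also have "1 \<le> 1 + (norm k)\<^sup>2" by simp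
      finally show "norm ((cmod (fourier_meas M (transpose U *v k)))\<^sup>2 / (1 + (norm k)\<^sup>2)) \<le> 1"
        by (simp add: divide_le_eq_1 add_pos_nonneg del: transpose_matrix_vector)
    qed measurable
    have "(cmod (fourier_meas ?A k))\<^sup>2 / (1 + (norm k)\<^sup>2) \<le> (\<integral>U. (cmod (fourier_meas M (transpose U *v k)))\<^sup>2 \<partial>H) / (1 + (norm k)\<^sup>2)"
      unfolding fourier_meas_rotation_average[OF H M sets]
      by (intro divide_right_mono H.norm_integral_power2_le[OF g, of 1] cmod_fourier_meas_le_1[OF M]) auto
    also have "\<dots> = (\<integral>U. (cmod (fourier_meas M (transpose U *v k)))\<^sup>2 / (1 + (norm k)\<^sup>2) \<partial>H)"
      by simp
    finally show "ennreal ((cmod (fourier_meas ?A k))\<^sup>2 / (1 + (norm k)\<^sup>2)) \<le> (\<integral>\<^sup>+ U. ennreal ((cmod (fourier_meas M (transpose U *v k)))\<^sup>2 / (1 + (norm k)\<^sup>2)) \<partial>H)"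
      using i by (subst nn_integral_eq_integral) (auto intro!: ennreal_leI)
  qed
  also have "\<dots> = (\<integral>\<^sup>+ U. (\<integral>\<^sup>+ k. ennreal ((cmod (fourier_meas M (transpose U *v k)))\<^sup>2 / (1 + (norm k)\<^sup>2)) \<partial>lborel) \<partial>H)"
    by (rule HL.Fubini'[OF pair])
  also have "\<dots> = (\<integral>\<^sup>+ U. (\<integral>\<^sup>+ k. ennreal ((cmod (fourier_meas M k))\<^sup>2 / (1 + (norm k)\<^sup>2)) \<partial>lborel) \<partial>H)"
  proof (rule nn_integral_cong_AE)
    show "AE U in H. (\<integral>\<^sup>+ k. ennreal ((cmod (fourier_meas M (transpose U *v k)))\<^sup>2 / (1 + (norm k)\<^sup>2)) \<partial>lborel)
      = (\<integral>\<^sup>+ k. ennreal ((cmod (fourier_meas M k))\<^sup>2 / (1 + (norm k)\<^sup>2)) \<partial>lborel)"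
      using haar_AE_SO3[OF H]
    proof eventually_elim
      case (elim U)
      have [measurable]: "(\<lambda>x. transpose U *v x) \<in> borel_measurable borel"
        using borel_measurable_matrix_vector_mult[of "\<lambda>_. transpose U" borel "\<lambda>x. x"] by simp
      have "(\<integral>\<^sup>+ k. ennreal ((cmod (fourier_meas M k))\<^sup>2 / (1 + (norm k)\<^sup>2)) \<partial>lborel)
        = (\<integral>\<^sup>+ k. ennreal ((cmod (fourier_meas M k))\<^sup>2 / (1 + (norm k)\<^sup>2)) \<partial>distr lborel borel (\<lambda>x. transpose U *v x))"
        by (simp only: distr_lborel_SO3[OF SO3_transpose[OF elim]])
      also have "\<dots> = (\<integral>\<^sup>+ k. ennreal ((cmod (fourier_meas M (transpose U *v k)))\<^sup>2 / (1 + (norm (transpose U *v k))\<^sup>2)) \<partial>lborel)"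
        by (rule nn_integral_distr) measurable
      finally show ?case unfolding SO3_norm[OF SO3_transpose[OF elim]] by (rule sym)
    qed
  qed
  also have "\<dots> < \<infinity>" using four by (simp add: H.emeasure_space_1)
  finally show ?thesis
    using fin prob_space_rotation_average[OF H M sets]
    by (simp add: D_s_def borel_prob_def moment_rotation_average[OF H M sets])
qed

section \<open>Comparison of the two infima\<close>

theorem theorem4p2:
  fixes s :: real
  assumes "1 \<le> s" and "s \<le> 3"
  shows "beta s = beta_rad s"
proof (cases "\<exists>H. haar_SO3 H")
  case False
  then have "radial M" for M by (simp add: radial_def)
  then show ?thesis by (simp add: beta_def beta_rad_def)
next
  case True
  then obtain H where H: "haar_SO3 H" ..
  show ?thesis
  proof (rule antisym)
    show "beta s \<le> beta_rad s"
      unfolding beta_def beta_rad_def by (rule Inf_superset_mono) auto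
    show "beta_rad s \<le> beta s"
      unfolding beta_def
    proof (rule Inf_greatest, clarify)
      fix M assume D: "D_s s M"
      then have M: "prob_space M" and sets: "sets M = sets borel" and fin: "moment s M < \<infinity>"
        by (auto simp: D_s_def borel_prob_def)
      let ?A = "rotation_average H M"
      have "beta_rad s \<le> I_s s ?A / moment s ?A"
        unfolding beta_rad_def using D_s_rotation_average[OF H D] radial_rotation_average[OF H M sets]
        by (intro Inf_lower) auto
      also have "\<dots> \<le> I_s s M / moment s M"
        unfolding moment_rotation_average[OF H M sets]
        using I_s_rotation_average_le[OF H M sets assms(1)] I_s_ge_radial_part[OF H M sets fin assms]
        by (intro divide_right_mono_ennreal) (rule order_trans)
      finally show "beta_rad s \<le> I_s s M / moment s M" .
    qed
  qed
qed

end
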